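(* Let $n$ be a positive integer, let $p_0,p_1,\ldots,p_n$ be polynomials (in $x$) such that $\deg p_0>\deg p_k$ for each $k\in\{1,2,\ldots,n\}$, and let $f$ be a non-trivial (i.e. not identically zero) meromorphic solution on $\mathbb{C}$ of the Wilson difference equation $$p_n\mathcal{D}_{\mathrm{W}}^ny+p_{n-1}\mathcal{D}_{\mathrm{W}}^{n-1}y+\cdots+p_1\mathcal{D}_{\mathrm{W}}y+p_0y=0.$$ Then $f$ has order $\sigma\ge\frac12$.
   Context: The Wilson operator $\mathcal{D}_{\mathrm{W}}$: for $x\ne0$ and $z$ with $z^2=x$, $$(\mathcal{D}_{\mathrm{W}}f)(x):=\frac{f((z+\frac i2)^2)-f((z-\frac i2)^2)}{2iz},$$ which does not depend on the choice of $z$; at $x=0$ the value is the limit as $x\to0$, which is $f'(-\frac14)$ if $f$ is differentiable at $-\frac14$. If $f$ is meromorphic on $\mathbb{C}$, so is $\mathcal{D}_{\mathrm{W}}f$; $\mathcal{D}_{\mathrm{W}}^k$ is the $k$-fold iterate. The order of a meromorphic function $f$ is $\limsup_{r\to\infty}\frac{\ln^+T(r,f)}{\ln r}\in[0,+\infty]$, with $T$ the Nevanlinna characteristic. *)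

theory Defs
  imports "HOL-Complex_Analysis.Complex_Analysis"
begin

text \<open>
  A meromorphic function on the complex plane is represented, as in the library, by a total function
  \<open>f\<close> with \<open>f meromorphic_on UNIV\<close>. Its values on a sparse set (in particular at the poles) carry no
  meaning, so identities between meromorphic functions are stated up to sparse sets
  (\<open>\<forall>\<^sub>\<approx>\<close>). All notions below are insensitive to changing \<open>f\<close> on a sparse set, the Wilson
  operator up to such a set again.
\<close>

definition wilson_quot :: "(complex \<Rightarrow> complex) \<Rightarrow> complex \<Rightarrow> complex" where
  "wilson_quot f z = (f ((z + \<i> / 2)\<^sup>2) - f ((z - \<i> / 2)\<^sup>2)) / (2 * \<i> * z)"

definition wilson :: "(complex \<Rightarrow> complex) \<Rightarrow> complex \<Rightarrow> complex" where
  "wilson f x = (if x = 0 then Lim (at 0) (\<lambda>t. wilson_quot f (csqrt t))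
                 else wilson_quot f (csqrt x))"

lemma wilson_quot_minus: "wilson_quot f (-z) = wilson_quot f z"
proof -
  have "(- z + \<i> / 2)\<^sup>2 = (z - \<i> / 2)\<^sup>2" "(- z - \<i> / 2)\<^sup>2 = (z + \<i> / 2)\<^sup>2"
    by (simp_all add: power2_eq_square algebra_simps)
  thus ?thesis
    by (simp add: wilson_quot_def minus_divide_left)
qed

lemma wilson_eq:
  assumes "x \<noteq> 0" "z\<^sup>2 = x"
  shows   "wilson f x = (f ((z + \<i> / 2)\<^sup>2) - f ((z - \<i> / 2)\<^sup>2)) / (2 * \<i> * z)"
proof -
  have "(csqrt x)\<^sup>2 = z\<^sup>2"
    using assms by simp
  hence "csqrt x = z \<or> csqrt x = -z"
    by (simp only: power2_eq_iff)
  hence "wilson_quot f (csqrt x) = wilson_quot f z"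
    by (auto simp: wilson_quot_minus)
  thus ?thesis
    using assms by (simp add: wilson_def wilson_quot_def)
qed

lemma wilson_0:
  assumes "f field_differentiable (at (-1/4))"
  shows   "wilson f 0 = deriv f (-1/4)"
proof -
  define D where "D = deriv f (-1/4)"
  have "(f has_field_derivative D) (at (-1/4))"
    using assms unfolding D_def by (simp add: DERIV_deriv_iff_field_differentiable)
  then obtain g where g: "\<And>w. f w - f (-1/4) = g w * (w - (-1/4))" "isCont g (-1/4)" "g (-1/4) = D"
    by (auto simp: DERIV_caratheodory_within continuous_within)
  define u v where "u = (\<lambda>z::complex. (z + \<i> / 2)\<^sup>2)" and "v = (\<lambda>z::complex. (z - \<i> / 2)\<^sup>2)"
  have uv: "u z + 1/4 = z * (z + \<i>)" "v z + 1/4 = z * (z - \<i>)" for z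
    by (auto simp: u_def v_def power2_eq_square field_simps)
  have quot: "wilson_quot f z = (g (u z) * (z + \<i>) - g (v z) * (z - \<i>)) / (2 * \<i>)"
    if "z \<noteq> 0" for z
  proof -
    have "f (u z) - f (v z) = (f (u z) - f (-1/4)) - (f (v z) - f (-1/4))"
      by simp
    also have "\<dots> = g (u z) * (u z + 1/4) - g (v z) * (v z + 1/4)"
      by (simp only: g(1)) simp
    also have "\<dots> = z * (g (u z) * (z + \<i>) - g (v z) * (z - \<i>))"
      by (simp add: uv algebra_simps)
    finally show ?thesis
      using that by (simp add: wilson_quot_def u_def v_def)
  qed
  have "u 0 = -1/4" "v 0 = -1/4"
    by (simp_all add: u_def v_def power2_eq_square)
  moreover have "u \<midarrow>0\<rightarrow> u 0" "v \<midarrow>0\<rightarrow> v 0"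
    unfolding u_def v_def by (intro tendsto_intros)+
  ultimately have "(\<lambda>z. g (u z)) \<midarrow>0\<rightarrow> D" "(\<lambda>z. g (v z)) \<midarrow>0\<rightarrow> D"
    using g(2,3) isCont_tendsto_compose[of "-1/4" g] by auto
  hence "(\<lambda>z. (g (u z) * (z + \<i>) - g (v z) * (z - \<i>)) / (2 * \<i>)) \<midarrow>0\<rightarrow>
          (D * (0 + \<i>) - D * (0 - \<i>)) / (2 * \<i>)"
    by (intro tendsto_intros) auto
  hence "(\<lambda>z. (g (u z) * (z + \<i>) - g (v z) * (z - \<i>)) / (2 * \<i>)) \<midarrow>0\<rightarrow> D"
    by simp
  hence lim: "wilson_quot f \<midarrow>0\<rightarrow> D"
    by (rule Lim_transform_eventually) (auto simp: eventually_at_filter quot)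
  have "csqrt \<midarrow>0\<rightarrow> 0"
  proof (rule tendsto_norm_zero_cancel)
    have "(\<lambda>t::complex. sqrt (norm t)) \<midarrow>0\<rightarrow> sqrt (norm (0::complex))"
      by (intro tendsto_intros)
    thus "(\<lambda>t. norm (csqrt t)) \<midarrow>0\<rightarrow> 0"
      by (simp add: norm_csqrt)
  qed
  hence "filterlim csqrt (at 0) (at 0)"
    by (auto simp: filterlim_at eventually_at_filter)
  from filterlim_compose[OF lim this] have "(\<lambda>t. wilson_quot f (csqrt t)) \<midarrow>0\<rightarrow> D" .
  thus ?thesis
    unfolding wilson_def D_def by (simp add: tendsto_Lim)
qed

definition ln_plus :: "real \<Rightarrow> real" where
  "ln_plus x = ln (max 1 x)"

text \<open>Number of poles in the closed disc of radius \<open>r\<close>, counted with multiplicity.\<close>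

definition pole_count :: "(complex \<Rightarrow> complex) \<Rightarrow> real \<Rightarrow> nat" where
  "pole_count f r = (\<Sum>z | z \<in> cball 0 r \<and> is_pole f z. nat (- zorder f z))"

definition nevanlinna_N :: "(complex \<Rightarrow> complex) \<Rightarrow> real \<Rightarrow> real" where
  "nevanlinna_N f r =
     integral {0..r} (\<lambda>t. (real (pole_count f t) - real (pole_count f 0)) / t)
     + real (pole_count f 0) * ln r"

definition nevanlinna_m :: "(complex \<Rightarrow> complex) \<Rightarrow> real \<Rightarrow> real" where
  "nevanlinna_m f r =
     1 / (2 * pi) * integral {0..2*pi} (\<lambda>\<theta>. ln_plus (norm (f (of_real r * cis \<theta>))))"

definition nevanlinna_T :: "(complex \<Rightarrow> complex) \<Rightarrow> real \<Rightarrow> real" where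
  "nevanlinna_T f r = nevanlinna_m f r + nevanlinna_N f r"

definition growth_order :: "(complex \<Rightarrow> complex) \<Rightarrow> ereal" where
  "growth_order f = Limsup at_top (\<lambda>r. ereal (ln_plus (nevanlinna_T f r) / ln r))"

end

theory Submission
  imports Defs "HOL-Real_Asymp.Real_Asymp"
begin

text \<open>
  Suppose that the order is less than \<open>1/2\<close>, so \<open>T(r, f) \<le> r\<^sup>\<rho>\<close> for large \<open>r\<close>, with \<open>\<rho> < 1/2\<close>. Put
  \<open>F(z) = f(z\<^sup>2)\<close>. The \<open>k\<close>-th Wilson iterate at \<open>z\<^sup>2\<close> is built from the values \<open>F(z + ij/2)\<close>,
  \<open>\<bar>j\<bar> \<le> k\<close>, and for large \<open>z\<close> it is at most their maximum. Hence if arbitrarily large \<open>z\<close> exist with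
  \<open>\<bar>F(z + ij/2)\<bar> \<le> C \<bar>F(z)\<bar> \<noteq> 0\<close> for all \<open>\<bar>j\<bar> \<le> n\<close>, the equation gives \<open>\<bar>p\<^sub>0\<bar> \<le> C (\<bar>p\<^sub>1\<bar> + \<dots> + \<bar>p\<^sub>n\<bar>)\<close>
  at \<open>z\<^sup>2\<close>, which contradicts the degree condition.

  To find \<open>z\<close>, write \<open>f = g / Q\<close> on a large disc, where the polynomial \<open>Q\<close> has the poles of \<open>f\<close> as its
  zeros. Dividing \<open>f\<close> by Blaschke factors and applying the Poisson formula to the logarithm of the
  quotient bounds \<open>ln \<bar>g\<bar>\<close> by a multiple of \<open>m(r, f) + n(r) ln r\<close>. Since \<open>2\<rho> < 1\<close>, both the growth of
  the maximum modulus of \<open>g(z\<^sup>2)\<close> and the influence of the zeros of \<open>Q(z\<^sup>2)\<close> are small on average over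
  radii up to \<open>R\<close>. At a radius where both are small, a point \<open>z\<close> near the maximum of \<open>\<bar>g(z\<^sup>2)\<bar>\<close> works.
\<close>

section \<open>The Poisson formula\<close>

text \<open>For \<open>c \<noteq> 0\<close> the denominator vanishes only at the reflection
  \<open>S\<^sup>2 / cnj c\<close> of \<open>c\<close> in the circle of radius \<open>S\<close>,
  which lies outside the closed disc.\<close>

lemma blaschke_denom_nonzero:
  assumes "norm c < S" "norm x \<le> S"
  shows "of_real (S\<^sup>2) - cnj c * x \<noteq> 0"
proof -
  have S: "S > 0"
    using assms(1) by (meson norm_ge_zero le_less_trans)
  have "norm (cnj c * x) \<le> norm c * S"
    using assms by (auto simp: norm_mult intro: mult_left_mono)
  also have "\<dots> < S * S"
    using assms S by (intro mult_strict_right_mono) auto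
  finally have "norm (cnj c * x) < norm (of_real (S\<^sup>2) :: complex)"
    using S by (simp only: norm_of_real) (simp add: power2_eq_square)
  thus ?thesis
    by (metis eq_iff_diff_eq_0 less_irrefl)
qed

lemma poisson_formula:
  assumes h: "h holomorphic_on cball 0 S" and z: "norm z < S"
  shows "((\<lambda>t. of_real ((S\<^sup>2 - (norm z)\<^sup>2) / (norm (of_real S * cis t - z))\<^sup>2) * h (of_real S * cis t))
           has_integral (2 * of_real pi * h z)) {0..2*pi}"
proof -
  have S: "S > 0"
    using z by (meson norm_ge_zero le_less_trans)
  have den: "of_real (S\<^sup>2) - cnj z * u \<noteq> 0" if "u \<in> cball 0 S" for u
    using blaschke_denom_nonzero[OF z, of u] that by simp
  have "((\<lambda>u. h u / (u - z)) has_contour_integral (2 * of_real pi * \<i> * h z)) (circlepath 0 S)"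
    using h z by (intro Cauchy_integral_circlepath_simple) auto
  \<comment> \<open>Adding this vanishing integral turns the Cauchy kernel into the Poisson kernel.\<close>
  moreover have "((\<lambda>u. h u * cnj z / (of_real (S\<^sup>2) - cnj z * u)) has_contour_integral 0) (circlepath 0 S)"
  proof (rule Cauchy_theorem_convex_simple)
    show "(\<lambda>u. h u * cnj z / (of_real (S\<^sup>2) - cnj z * u)) holomorphic_on cball 0 S"
      using h den by (intro holomorphic_intros) auto
  qed (use S in auto)
  ultimately have "((\<lambda>u. h u / (u - z) + h u * cnj z / (of_real (S\<^sup>2) - cnj z * u))
      has_contour_integral (2 * of_real pi * \<i> * h z + 0)) (circlepath 0 S)"
    by (rule has_contour_integral_add)
  hence "((\<lambda>t. (h (S * cis t) / (S * cis t - z) + h (S * cis t) * cnj z / (of_real (S\<^sup>2) - cnj z * (S * cis t))) *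
        S * \<i> * cis t) has_integral (2 * of_real pi * \<i> * h z)) {0..2*pi}"
    unfolding circlepath_def by (subst (asm) has_contour_integral_part_circlepath_iff) auto
  hence int: "((\<lambda>t. (h (S * cis t) / (S * cis t - z) + h (S * cis t) * cnj z / (of_real (S\<^sup>2) - cnj z * (S * cis t))) *
        S * \<i> * cis t * (-\<i>)) has_integral (2 * of_real pi * \<i> * h z * (-\<i>))) {0..2*pi}"
    by (rule has_integral_mult_left)
  have eq: "(h (S * cis t) / (S * cis t - z) + h (S * cis t) * cnj z / (of_real (S\<^sup>2) - cnj z * (S * cis t))) *
        S * \<i> * cis t * (-\<i>) =
      of_real ((S\<^sup>2 - (norm z)\<^sup>2) / (norm (of_real S * cis t - z))\<^sup>2) * h (of_real S * cis t)" for t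
  proof -
    define w where "w = of_real S * cis t"
    have nw: "norm w = S"
      using S by (simp add: w_def norm_mult)
    have S2: "of_real (S\<^sup>2) = w * cnj w"
      using nw by (metis complex_norm_square of_real_power)
    have z2: "of_real ((norm z)\<^sup>2) = z * cnj z"
      by (metis complex_norm_square of_real_power)
    have n2: "of_real ((norm (w - z))\<^sup>2) = (w - z) * (cnj w - cnj z)"
      by (metis complex_norm_square of_real_power complex_cnj_diff)
    have ne: "w \<noteq> z" "cnj w \<noteq> cnj z" "w \<noteq> 0"
      using nw z S by auto
    have "(h w / (w - z) + h w * cnj z / (of_real (S\<^sup>2) - cnj z * w)) * w =
        (h w / (w - z) + h w * cnj z / (w * (cnj w - cnj z))) * w"
      unfolding S2 by (simp add: algebra_simps)
    also have "\<dots> = (w * cnj w - z * cnj z) / ((w - z) * (cnj w - cnj z)) * h w"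
      using ne by (simp add: divide_simps) (simp add: algebra_simps)
    also have "\<dots> = of_real ((S\<^sup>2 - (norm z)\<^sup>2) / (norm (w - z))\<^sup>2) * h w"
      by (simp only: of_real_divide of_real_diff S2 z2 n2)
    finally show ?thesis
      unfolding w_def by (simp add: mult_ac)
  qed
  show ?thesis
    using int unfolding eq by (simp add: mult_ac)
qed

text \<open>On a disc without zeros, \<open>ln (norm (H x))\<close> is the real part of a
  holomorphic logarithm, so the Poisson formula applies to it. The kernel is nonnegative and at most
  \<open>(S + norm z) / (S - norm z)\<close>; passing from \<open>ln\<close> to
  \<open>ln_plus\<close> before estimating the kernel gives the bound.\<close>

lemma ln_norm_le_poisson:
  assumes H: "H holomorphic_on ball 0 S'" "\<And>x. x \<in> ball 0 S' \<Longrightarrow> H x \<noteq> 0"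
    and S: "S < S'" and z: "norm z < S"
  shows "ln (norm (H z)) \<le> (S + norm z) / (S - norm z) *
    (1 / (2 * pi) * integral {0..2*pi} (\<lambda>t. ln_plus (norm (H (of_real S * cis t)))))"
proof -
  define K where "K = (S + norm z) / (S - norm z)"
  define P where "P = (\<lambda>t. (S\<^sup>2 - (norm z)\<^sup>2) / (norm (of_real S * cis t - z))\<^sup>2)"
  have S0: "S > 0"
    using z by (meson norm_ge_zero le_less_trans)
  obtain h where h: "h holomorphic_on ball 0 S'" "\<And>x. x \<in> ball 0 S' \<Longrightarrow> H x = exp (h x)"
    using contractible_imp_holomorphic_log[OF H(1) _ H(2)] convex_imp_contractible convex_ball by metis
  have Re_h: "Re (h x) = ln (norm (H x))" if "x \<in> ball 0 S'" for x
    using h(2)[OF that] by simp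
  have circ: "of_real S * cis t \<in> ball 0 S'" for t
    using S S0 by (simp add: norm_mult)
  have hol: "h holomorphic_on cball 0 S"
    using h(1) S by (auto elim!: holomorphic_on_subset)
  have "((\<lambda>t. Re (of_real (P t) * h (of_real S * cis t))) has_integral (Re (2 * of_real pi * h z))) {0..2*pi}"
    using has_integral_linear[OF poisson_formula[OF hol z] bounded_linear_Re]
    by (simp add: o_def P_def)
  hence int: "((\<lambda>t. P t * ln (norm (H (of_real S * cis t)))) has_integral (2 * pi * ln (norm (H z)))) {0..2*pi}"
    using Re_h[OF circ] Re_h[of z] z S by simp
  have cont: "continuous_on {0..2*pi} (\<lambda>t. ln_plus (norm (H (of_real S * cis t))))"
  proof -
    have "continuous_on (ball 0 S') H"
      using H(1) by (rule holomorphic_on_imp_continuous_on)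
    hence "continuous_on {0..2*pi} (\<lambda>t. H (of_real S * cis t))"
      by (rule continuous_on_compose2) (use circ in \<open>auto intro!: continuous_intros\<close>)
    thus ?thesis
      unfolding ln_plus_def by (intro continuous_intros) auto
  qed
  have "2 * pi * ln (norm (H z)) \<le> K * integral {0..2*pi} (\<lambda>t. ln_plus (norm (H (of_real S * cis t))))"
  proof (rule has_integral_le[OF int])
    show "((\<lambda>t. K * ln_plus (norm (H (of_real S * cis t)))) has_integral
        K * integral {0..2*pi} (\<lambda>t. ln_plus (norm (H (of_real S * cis t))))) {0..2*pi}"
      by (intro has_integral_mult_right integrable_integral integrable_continuous_real cont)
    fix t :: real
    have "S - norm z \<le> norm (of_real S * cis t - z)"
      using norm_triangle_ineq2[of "of_real S * cis t" z] S0 by (simp add: norm_mult)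
    hence "(S - norm z)\<^sup>2 \<le> (norm (of_real S * cis t - z))\<^sup>2"
      using z by (intro power_mono) auto
    hence "P t \<le> (S\<^sup>2 - (norm z)\<^sup>2) / (S - norm z)\<^sup>2"
      unfolding P_def using z S0 by (intro divide_left_mono) (auto intro!: mult_pos_pos power_mono)
    also have "\<dots> = K"
      using z by (simp add: K_def power2_eq_square divide_simps) (simp add: algebra_simps)
    finally have PK: "P t \<le> K" .
    have P0: "P t \<ge> 0"
      unfolding P_def using z S0 by (intro divide_nonneg_nonneg) (auto intro!: power_mono)
    have "ln (norm (H (of_real S * cis t))) \<le> ln_plus (norm (H (of_real S * cis t)))"
      using H(2)[OF circ] by (simp add: ln_plus_def)
    hence "P t * ln (norm (H (of_real S * cis t))) \<le> P t * ln_plus (norm (H (of_real S * cis t)))"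
      using P0 by (rule mult_left_mono)
    also have "\<dots> \<le> K * ln_plus (norm (H (of_real S * cis t)))"
      using PK by (rule mult_right_mono) (simp add: ln_plus_def)
    finally show "P t * ln (norm (H (of_real S * cis t))) \<le> K * ln_plus (norm (H (of_real S * cis t)))" .
  qed
  thus ?thesis
    unfolding K_def[symmetric] by (simp add: field_simps)
qed

section \<open>Dividing out zeros and poles\<close>

text \<open>At a pole, \<open>- zorder f c\<close> is the multiplicity, so the degree in
  \<open>x\<close> is \<open>pole_count f r\<close>, and multiplying \<open>f\<close> by this
  polynomial clears its poles in the closed disc.\<close>

definition pole_poly :: "(complex \<Rightarrow> complex) \<Rightarrow> real \<Rightarrow> complex \<Rightarrow> complex" where
  "pole_poly f r x = (\<Prod>c | c \<in> cball 0 r \<and> is_pole f c. (x - c) ^ nat (- zorder f c))"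

text \<open>The Blaschke factor of the disc of radius \<open>S\<close>, scaled to have modulus 1 on
  the boundary circle.\<close>

definition blaschke :: "real \<Rightarrow> complex \<Rightarrow> complex \<Rightarrow> complex" where
  "blaschke S c x = of_real S * (x - c) / (of_real (S\<^sup>2) - cnj c * x)"

text \<open>The sign of the right-hand side decides whether a Blaschke factor has modulus below,
  equal to or above 1.\<close>

lemma blaschke_norm_identity:
  "(norm (of_real (S\<^sup>2) - cnj c * x))\<^sup>2 - (norm (of_real S * (x - c)))\<^sup>2 =
     (S\<^sup>2 - (norm x)\<^sup>2) * (S\<^sup>2 - (norm c)\<^sup>2)"
  unfolding cmod_power2 by (simp add: power2_eq_square algebra_simps)

lemma norm_blaschke_le_1:
  assumes "norm c < S" "norm x \<le> S"
  shows "norm (blaschke S c x) \<le> 1"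
proof -
  have "(S\<^sup>2 - (norm x)\<^sup>2) * (S\<^sup>2 - (norm c)\<^sup>2) \<ge> 0"
    using assms by (intro mult_nonneg_nonneg) (auto intro!: power_mono)
  hence "(norm (of_real S * (x - c)))\<^sup>2 \<le> (norm (of_real (S\<^sup>2) - cnj c * x))\<^sup>2"
    using blaschke_norm_identity[of S c x] by linarith
  hence "norm (of_real S * (x - c)) \<le> norm (of_real (S\<^sup>2) - cnj c * x)"
    by (rule power2_le_imp_le) auto
  thus ?thesis
    using blaschke_denom_nonzero[OF assms] unfolding blaschke_def norm_divide
    by (subst pos_divide_le_eq) auto
qed

lemma norm_blaschke_eq_1:
  assumes "norm c < S" "norm x = S"
  shows "norm (blaschke S c x) = 1"
proof -
  have "(norm (of_real S * (x - c)))\<^sup>2 = (norm (of_real (S\<^sup>2) - cnj c * x))\<^sup>2"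
    using blaschke_norm_identity[of S c x] assms by simp
  hence "norm (of_real S * (x - c)) = norm (of_real (S\<^sup>2) - cnj c * x)"
    by (simp add: power2_eq_iff_nonneg)
  thus ?thesis
    using blaschke_denom_nonzero[of c S x] assms unfolding blaschke_def norm_divide by simp
qed

lemma blaschke_eq_0_iff:
  assumes "norm c < S" "norm x \<le> S"
  shows "blaschke S c x = 0 \<longleftrightarrow> x = c"
proof -
  have "S \<noteq> 0"
    using assms(1) norm_ge_zero[of c] by linarith
  thus ?thesis
    using blaschke_denom_nonzero[OF assms] by (simp add: blaschke_def)
qed

lemma blaschke_analytic:
  assumes "norm c < S" "norm x \<le> S"
  shows "blaschke S c analytic_on {x}"
  unfolding blaschke_def using blaschke_denom_nonzero[OF assms]
  by (intro analytic_intros) auto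

lemma zorder_blaschke:
  assumes "norm c < S" "norm x \<le> S"
  shows "zorder (blaschke S c) x = (if x = c then 1 else 0)"
proof (cases "x = c")
  case False
  thus ?thesis
    using blaschke_analytic[OF assms] blaschke_eq_0_iff[OF assms] by (auto intro!: zorder_eq_0I)
next
  case True
  have S: "S > 0"
    using assms(1) by (meson norm_ge_zero le_less_trans)
  define A where "A = {x. of_real (S\<^sup>2) - cnj c * x \<noteq> 0}"
  have "open A"
    unfolding A_def by (intro open_Collect_neq continuous_intros)
  moreover have "c \<in> A"
    using blaschke_denom_nonzero[of c S c] assms by (simp add: A_def)
  moreover have "(\<lambda>x. of_real S / (of_real (S\<^sup>2) - cnj c * x)) holomorphic_on A"
    by (intro holomorphic_intros) (auto simp: A_def)
  ultimately have "zorder (blaschke S c) c = 1"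
    using S by (intro zorder_eqI[of A _ "\<lambda>x. of_real S / (of_real (S\<^sup>2) - cnj c * x)"])
      (auto simp: blaschke_def A_def)
  thus ?thesis
    using True by simp
qed

text \<open>A pole would make the order negative and an isolated zero would make it positive.
  Nonvanishing near \<open>z\<close> is what turns a limit 0 into an isolated zero.\<close>

lemma remove_sings_zorder_0:
  assumes f: "f meromorphic_on {z}" "\<forall>\<^sub>F w in at z. f w \<noteq> 0" and "zorder f z = 0"
  shows "remove_sings f analytic_on {z}" "remove_sings f z \<noteq> 0"
proof -
  have iso: "isolated_singularity_at f z" "not_essential f z"
    using f(1) by (auto simp: meromorphic_at_iff)
  have np: "\<not> is_pole f z"
    using isolated_pole_imp_neg_zorder[OF iso(1)] assms(3) by auto
  have nz: "\<not> isolated_zero f z"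
    using zorder_isolated_zero_pos'[OF _ iso(1)] assms(3) by auto
  show "remove_sings f analytic_on {z}"
    using iso np by (auto simp: not_essential_def intro: remove_sings_analytic_at)
  show "remove_sings f z \<noteq> 0"
    using remove_sings_eq_0_iff[OF iso(2)] np nz f(2) by (auto simp: isolated_zero_def)
qed

lemma finite_non_regular:
  assumes "\<forall>\<^sub>\<approx>x\<in>UNIV. P x"
  shows "finite {x \<in> cball (0 :: complex) S. \<not> P x}"
proof -
  have "finite (cball 0 S \<inter> {x. \<not> P x})"
    using assms sparse_in_subset[of "{x. \<not> P x}" UNIV "cball 0 S"]
    by (intro sparse_in_compact_finite) (auto simp: eventually_cosparse)
  thus ?thesis
    by (simp add: Int_def)
qed

lemma finite_poles:
  assumes "f meromorphic_on UNIV"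
  shows "finite {c. c \<in> cball 0 r \<and> is_pole f c}"
  using finite_non_regular[OF meromorphic_on_imp_not_pole_cosparse[OF assms], of r] by simp

lemma regular_cosparse:
  assumes "f meromorphic_on UNIV" "\<forall>\<^sub>\<approx>x\<in>UNIV. f x \<noteq> 0"
  shows "\<forall>\<^sub>\<approx>x\<in>UNIV. f analytic_on {x} \<and> f x \<noteq> 0"
  using meromorphic_on_imp_analytic_cosparse[OF assms(1)] assms(2) by eventually_elim auto

text \<open>Dividing out all zeros and poles by Blaschke factors leaves a zero-free analytic
  function \<open>H\<close> with the same modulus as \<open>f\<close> on the circle, and the Poisson
  bound applies to it. At \<open>z\<close>, each factor of the pole polynomial is at most
  \<open>2 * S\<close> times the corresponding Blaschke factor, while the factors belonging to zeros
  have modulus at least 1 and only help.\<close>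

lemma norm_mult_pole_poly_le:
  assumes f: "f meromorphic_on UNIV" "\<forall>\<^sub>\<approx>x\<in>UNIV. f x \<noteq> 0"
    and S: "\<And>x. norm x = S \<Longrightarrow> f analytic_on {x} \<and> f x \<noteq> 0"
    and z: "norm z < S" "f analytic_on {z}" "f z \<noteq> 0"
  shows "norm (f z * pole_poly f S z) \<le> exp ((S + norm z) / (S - norm z) * nevanlinna_m f S) * (2 * S) ^ pole_count f S"
proof -
  have S0: "S > 0"
    using z by (meson norm_ge_zero le_less_trans)
  \<comment> \<open>\<open>Z\<close> collects zeros and poles alike. Regularity on the circle keeps
    all of them strictly inside the disc.\<close>
  define Z where "Z = {x \<in> cball 0 S. zorder f x \<noteq> 0}"
  have "Z \<subseteq> {x \<in> cball 0 S. \<not> (f analytic_on {x} \<and> f x \<noteq> 0)}"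
    using zorder_eq_0I by (auto simp: Z_def)
  hence finZ: "finite Z"
    using finite_non_regular[OF regular_cosparse[OF f]] by (rule finite_subset)
  have Z_less: "norm c < S" if "c \<in> Z" for c
  proof -
    have "norm c \<noteq> S"
      using S[of c] that zorder_eq_0I by (auto simp: Z_def)
    thus ?thesis
      using that by (auto simp: Z_def)
  qed
  have zZ: "z \<notin> Z"
    using z zorder_eq_0I by (auto simp: Z_def)
  \<comment> \<open>The exponents cancel the order of \<open>f\<close> at each point of
    \<open>Z\<close>, so \<open>f x * B x\<close> has order 0 throughout the closed disc.\<close>
  define B where "B = (\<lambda>x. \<Prod>c\<in>Z. blaschke S c x powi (- zorder f c))"
  define H0 where "H0 = (\<lambda>x. f x * B x)"
  define H where "H = remove_sings H0"
  have bl_mero: "blaschke S c meromorphic_on {x}" if "c \<in> Z" "norm x \<le> S" for c x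
    using blaschke_analytic[OF Z_less that(2)] that(1) by (intro analytic_on_imp_meromorphic_on)
  have bl_ev: "\<forall>\<^sub>F w in at x. blaschke S c w \<noteq> 0" if c: "c \<in> Z" and x: "norm x \<le> S" for c x
  proof -
    have "\<forall>\<^sub>F w in at x. of_real (S\<^sup>2) - cnj c * w \<noteq> 0"
      using blaschke_denom_nonzero[OF Z_less[OF c] x]
      by (intro tendsto_imp_eventually_ne[where c = "of_real (S\<^sup>2) - cnj c * x"] tendsto_intros)
    moreover have "\<forall>\<^sub>F w in at x. w \<noteq> c"
      by (rule eventually_neq_at_within)
    ultimately show ?thesis
      by eventually_elim (use S0 in \<open>auto simp: blaschke_def\<close>)
  qed
  have B_ev: "\<forall>\<^sub>F w in at x. B w \<noteq> 0" if x: "norm x \<le> S" for x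
  proof -
    have "\<forall>\<^sub>F w in at x. \<forall>c\<in>Z. blaschke S c w \<noteq> 0"
      using bl_ev x finZ by (intro eventually_ball_finite) auto
    thus ?thesis
      by eventually_elim (use finZ in \<open>auto simp: B_def\<close>)
  qed
  have B_mero: "B meromorphic_on {x}" if x: "norm x \<le> S" for x
    unfolding B_def using bl_mero x by (intro meromorphic_intros) auto
  have f_ev: "\<forall>\<^sub>F w in at x. f w \<noteq> 0" for x
    using f(2) by (simp add: eventually_cosparse_open_eq)
  have f_mero: "f meromorphic_on {x}" for x
    using f(1) by (rule meromorphic_on_subset) auto
  have zo: "zorder H0 x = 0" if x: "norm x \<le> S" for x
  proof -
    have "zorder B x = (\<Sum>c\<in>Z. zorder (\<lambda>w. blaschke S c w powi (- zorder f c)) x)"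
      unfolding B_def
      by (rule zorder_prod) (use bl_mero x B_ev[OF x] in \<open>auto intro!: meromorphic_intros simp: B_def\<close>)
    also have "\<dots> = (\<Sum>c\<in>Z. - zorder f c * (if x = c then 1 else 0))"
    proof (rule sum.cong)
      fix c assume c: "c \<in> Z"
      have "zorder (\<lambda>w. blaschke S c w powi (- zorder f c)) x = - zorder f c * zorder (blaschke S c) x"
        using bl_mero[OF c x] bl_ev[OF c x] by (intro zorder_power_int) (auto simp: eventually_frequently)
      thus "zorder (\<lambda>w. blaschke S c w powi (- zorder f c)) x = - zorder f c * (if x = c then 1 else 0)"
        using zorder_blaschke[OF Z_less[OF c] x] by simp
    qed auto
    also have "\<dots> = (\<Sum>c\<in>Z. if x = c then - zorder f c else 0)"
      by (rule sum.cong) auto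
    also have "\<dots> = (if x \<in> Z then - zorder f x else 0)"
      using finZ by (simp add: sum.delta')
    also have "\<dots> = - zorder f x"
      using x by (auto simp: Z_def)
    finally show ?thesis
      unfolding H0_def using f_mero f_ev B_mero[OF x] B_ev[OF x]
      by (subst zorder_mult) (auto simp: eventually_frequently)
  qed
  have H0_mero: "H0 meromorphic_on {x}" if "norm x \<le> S" for x
    unfolding H0_def using f_mero B_mero[OF that] by (intro meromorphic_intros)
  have H0_ev: "\<forall>\<^sub>F w in at x. H0 w \<noteq> 0" if "norm x \<le> S" for x
    using f_ev[of x] B_ev[OF that] by eventually_elim (auto simp: H0_def)
  have H_an: "H analytic_on {x}" "H x \<noteq> 0" if "norm x \<le> S" for x
    unfolding H_def using remove_sings_zorder_0[OF H0_mero H0_ev zo] that by auto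
  have H_eq: "H x = H0 x" if "norm x \<le> S" "f analytic_on {x}" "x \<notin> Z" for x
  proof -
    have "B analytic_on {x}"
      unfolding B_def
    proof (rule analytic_on_prod)
      fix c assume c: "c \<in> Z"
      have "blaschke S c x \<noteq> 0"
        using blaschke_eq_0_iff[OF Z_less[OF c] that(1)] c that(3) by auto
      thus "(\<lambda>x. blaschke S c x powi (- zorder f c)) analytic_on {x}"
        using blaschke_analytic[OF Z_less[OF c] that(1)] by (intro analytic_intros) auto
    qed
    thus ?thesis
      unfolding H_def H0_def using that by (intro remove_sings_at_analytic analytic_intros)
  qed
  \<comment> \<open>The Poisson bound asks for a zero-free open disc around the closed one;
    compactness provides the margin.\<close>
  obtain S' where S': "S' > S" "H holomorphic_on ball 0 S'" "\<And>x. x \<in> ball 0 S' \<Longrightarrow> H x \<noteq> 0"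
  proof -
    have "H analytic_on cball 0 S"
      using H_an(1) by (subst analytic_on_analytic_at) auto
    then obtain T where T: "open T" "cball 0 S \<subseteq> T" "H holomorphic_on T"
      by (auto simp: analytic_on_holomorphic)
    define T' where "T' = {x \<in> T. H x \<noteq> 0}"
    have "open T'"
      using continuous_open_preimage[OF holomorphic_on_imp_continuous_on[OF T(3)] T(1), of "-{0}"]
        open_Compl[OF closed_singleton[of "0::complex"]]
      by (simp add: T'_def vimage_def Int_def)
    moreover have "cball 0 S \<subseteq> T'"
      using T(2) H_an(2) by (auto simp: T'_def)
    ultimately obtain e where e: "e > 0" "(\<Union>x\<in>cball 0 S. ball x e) \<subseteq> T'"
      using compact_subset_open_imp_ball_epsilon_subset[OF compact_cball] by metis
    have sub: "ball 0 (S + e) \<subseteq> T'"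
    proof
      fix x :: complex assume x: "x \<in> ball 0 (S + e)"
      show "x \<in> T'"
      proof (cases "norm x \<le> S")
        case True
        thus ?thesis
          using e by force
      next
        case False
        \<comment> \<open>The radial projection of \<open>x\<close> to the circle has distance
          \<open>norm x - S < e\<close> from \<open>x\<close>.\<close>
        define y where "y = of_real (S / norm x) * x"
        have "x \<noteq> 0"
          using False S0 by auto
        have "x - y = of_real (1 - S / norm x) * x"
          by (simp add: y_def algebra_simps)
        hence "norm (x - y) = \<bar>1 - S / norm x\<bar> * norm x"
          by (simp only: norm_mult norm_of_real)
        also have "\<bar>1 - S / norm x\<bar> = 1 - S / norm x"
          using False by (simp add: divide_simps)
        also have "(1 - S / norm x) * norm x = norm x - S"
          using \<open>x \<noteq> 0\<close> by (simp add: field_simps)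
        finally have "dist y x < e"
          using x by (simp add: dist_norm norm_minus_commute)
        moreover have "norm y = S"
          using \<open>x \<noteq> 0\<close> S0 by (simp add: y_def norm_mult norm_divide)
        ultimately have "x \<in> (\<Union>x\<in>cball 0 S. ball x e)"
          by (intro UN_I[of y]) auto
        thus ?thesis
          using e(2) by blast
      qed
    qed
    show ?thesis
    proof (rule that[of "S + e"])
      show "H holomorphic_on ball 0 (S + e)"
        using T(3) sub by (rule_tac holomorphic_on_subset) (auto simp: T'_def)
    qed (use e sub in \<open>auto simp: T'_def\<close>)
  qed
  have "ln (norm (H z)) \<le> (S + norm z) / (S - norm z) *
      (1 / (2 * pi) * integral {0..2*pi} (\<lambda>t. ln_plus (norm (H (of_real S * cis t)))))"
    using S' z by (intro ln_norm_le_poisson[of H S']) auto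
  also have "(\<lambda>t. ln_plus (norm (H (of_real S * cis t)))) = (\<lambda>t. ln_plus (norm (f (of_real S * cis t))))"
  proof
    fix t
    define x where "x = of_real S * cis t"
    have x: "norm x = S"
      using S0 by (simp add: x_def norm_mult)
    have "norm (B x) = 1"
      unfolding B_def prod_norm[symmetric] norm_power_int
      by (rule prod.neutral) (use norm_blaschke_eq_1 Z_less x in auto)
    moreover have "x \<notin> Z"
      using Z_less x by auto
    ultimately have "norm (H x) = norm (f x)"
      using H_eq[of x] S[of x] x by (auto simp: H0_def norm_mult)
    thus "ln_plus (norm (H (of_real S * cis t))) = ln_plus (norm (f (of_real S * cis t)))"
      by (simp add: x_def)
  qed
  finally have "ln (norm (H z)) \<le> (S + norm z) / (S - norm z) * nevanlinna_m f S"
    by (simp add: nevanlinna_m_def)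
  hence Hz: "norm (H z) \<le> exp ((S + norm z) / (S - norm z) * nevanlinna_m f S)"
    using H_an(2)[of z] z ln_ge_iff[of "norm (H z)"] by (metis exp_le_cancel_iff exp_ln less_imp_le zero_less_norm_iff)

  \<comment> \<open>Comparing the pole polynomial with the Blaschke product\<close>
  define P where "P = {c. c \<in> cball 0 S \<and> is_pole f c}"
  have PZ: "P = {c\<in>Z. zorder f c < 0}"
  proof -
    have "is_pole f c \<longleftrightarrow> zorder f c < 0" for c
      using zorder_neg_imp_is_pole[OF f_mero f_ev] isolated_pole_imp_neg_zorder[of f c] f_mero[of c]
      by (auto simp: meromorphic_at_iff)
    thus ?thesis
      by (auto simp: P_def Z_def)
  qed
  have bl_bd: "norm (blaschke S c z) \<le> 1" "norm (blaschke S c z) > 0" if "c \<in> Z" for c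
    using norm_blaschke_le_1[of c S z] blaschke_eq_0_iff[of c S z] Z_less[OF that] z zZ that by auto
  have "norm (pole_poly f S z) = (\<Prod>c\<in>P. norm (z - c) ^ nat (- zorder f c))"
    by (simp add: pole_poly_def P_def prod_norm[symmetric] norm_power)
  also have "\<dots> \<le> (\<Prod>c\<in>P. norm (blaschke S c z) ^ nat (- zorder f c) * (2 * S) ^ nat (- zorder f c))"
  proof (rule prod_mono)
    fix c assume "c \<in> P"
    hence c: "norm c < S"
      using Z_less PZ by auto
    \<comment> \<open>Both terms of the Blaschke denominator are at most \<open>S\<^sup>2\<close> in
      modulus; dividing by the \<open>S\<close> in the numerator yields the cost
      \<open>2 * S\<close> per pole.\<close>
    have "norm (of_real (S\<^sup>2) - cnj c * z) \<le> S\<^sup>2 + norm c * norm z"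
      using norm_triangle_ineq4[of "of_real (S\<^sup>2)" "cnj c * z"] by (simp add: norm_mult norm_power)
    also have "\<dots> \<le> S\<^sup>2 + S * S"
      using c z S0 by (intro add_mono mult_mono) auto
    finally have "norm (of_real (S\<^sup>2) - cnj c * z) \<le> 2 * S * S"
      by (simp add: power2_eq_square)
    hence le: "norm (z - c) * norm (of_real (S\<^sup>2) - cnj c * z) \<le> norm (z - c) * (2 * S * S)"
      by (intro mult_left_mono) auto
    have "norm (blaschke S c z) = S * norm (z - c) / norm (of_real (S\<^sup>2) - cnj c * z)"
      unfolding blaschke_def norm_divide norm_mult norm_of_real using S0 by simp
    moreover have "norm (of_real (S\<^sup>2) - cnj c * z) > 0"
      using blaschke_denom_nonzero[OF c, of z] z by simp
    ultimately have "norm (z - c) \<le> norm (blaschke S c z) * (2 * S)"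
      using le by (simp add: pos_le_divide_eq mult_ac)
    hence "norm (z - c) ^ nat (- zorder f c) \<le> (norm (blaschke S c z) * (2 * S)) ^ nat (- zorder f c)"
      by (intro power_mono) auto
    thus "0 \<le> norm (z - c) ^ nat (- zorder f c) \<and> norm (z - c) ^ nat (- zorder f c)
        \<le> norm (blaschke S c z) ^ nat (- zorder f c) * (2 * S) ^ nat (- zorder f c)"
      by (simp only: power_mult_distrib zero_le_power norm_ge_zero simp_thms)
  qed
  also have "\<dots> = (\<Prod>c\<in>P. norm (blaschke S c z) powi (- zorder f c)) * (2 * S) ^ pole_count f S"
  proof -
    have "(\<Prod>c\<in>P. norm (blaschke S c z) ^ nat (- zorder f c)) = (\<Prod>c\<in>P. norm (blaschke S c z) powi (- zorder f c))"
      by (rule prod.cong) (auto simp: PZ power_int_def)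
    thus ?thesis
      by (simp add: prod.distrib power_sum pole_count_def P_def)
  qed
  also have "(\<Prod>c\<in>P. norm (blaschke S c z) powi (- zorder f c)) \<le> (\<Prod>c\<in>Z. norm (blaschke S c z) powi (- zorder f c))"
  proof -
    have "(\<Prod>c\<in>Z. norm (blaschke S c z) powi (- zorder f c)) =
        (\<Prod>c\<in>P. norm (blaschke S c z) powi (- zorder f c)) * (\<Prod>c\<in>Z-P. norm (blaschke S c z) powi (- zorder f c))"
      using finZ by (subst prod.subset_diff[of P Z]) (auto simp: PZ mult_ac)
    \<comment> \<open>\<open>Z - P\<close> consists of the zeros, whose Blaschke factors carry a
      negative exponent.\<close>
    moreover have "(\<Prod>c\<in>Z-P. norm (blaschke S c z) powi (- zorder f c)) \<ge> (\<Prod>c\<in>Z-P. 1)"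
    proof (rule prod_mono)
      fix c assume c: "c \<in> Z - P"
      hence "zorder f c \<ge> 0"
        by (auto simp: PZ)
      hence "norm (blaschke S c z) powi (- zorder f c) = inverse (norm (blaschke S c z) ^ nat (zorder f c))"
        by (auto simp: power_int_def power_inverse)
      moreover have "norm (blaschke S c z) ^ nat (zorder f c) \<le> 1"
        using bl_bd[of c] c by (intro power_le_one) auto
      ultimately show "0 \<le> (1::real) \<and> 1 \<le> norm (blaschke S c z) powi (- zorder f c)"
        using bl_bd[of c] c by (auto simp: one_le_inverse_iff)
    qed
    moreover have "(\<Prod>c\<in>P. norm (blaschke S c z) powi (- zorder f c)) \<ge> 0"
      by (intro prod_nonneg) auto
    ultimately show ?thesis
      using mult_left_mono[of 1 _ "\<Prod>c\<in>P. norm (blaschke S c z) powi (- zorder f c)"] by simp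
  qed
  also have "(\<Prod>c\<in>Z. norm (blaschke S c z) powi (- zorder f c)) = norm (B z)"
    by (simp add: B_def prod_norm[symmetric] norm_power_int)
  finally have "norm (pole_poly f S z) \<le> norm (B z) * (2 * S) ^ pole_count f S"
    using S0 by (simp add: mult_right_mono)
  hence "norm (f z * pole_poly f S z) \<le> norm (f z) * (norm (B z) * (2 * S) ^ pole_count f S)"
    by (auto simp: norm_mult intro: mult_left_mono)
  also have "\<dots> = norm (H z) * (2 * S) ^ pole_count f S"
    using H_eq[of z] z zZ by (simp add: H0_def norm_mult)
  also have "\<dots> \<le> exp ((S + norm z) / (S - norm z) * nevanlinna_m f S) * (2 * S) ^ pole_count f S"
    using Hz S0 by (intro mult_right_mono) auto
  finally show ?thesis .
qed

lemma nevanlinna_m_nonneg: "nevanlinna_m f r \<ge> 0"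
proof -
  have "integral {0..2*pi} (\<lambda>\<theta>. ln_plus (norm (f (of_real r * cis \<theta>)))) \<ge> 0"
  \<comment> \<open>Without integrability the integral is 0 by convention, so the claim needs no
    regularity of \<open>f\<close>.\<close>
  proof (cases "(\<lambda>\<theta>. ln_plus (norm (f (of_real r * cis \<theta>)))) integrable_on {0..2*pi}")
    case True
    thus ?thesis
      by (rule integral_nonneg) (simp add: ln_plus_def)
  qed (simp add: not_integrable_integral)
  thus ?thesis
    by (simp add: nevanlinna_m_def)
qed

text \<open>The bound at regular points keeps the product with the pole polynomial bounded near
  every point of the disc, so its singularities there are removable, and the bound passes to the
  limits. On the disc of half the radius the Poisson quotient is at most
  \<open>(S + S/2) / (S - S/2) = 3\<close>.\<close>

lemma clear_poles:
  assumes f: "f meromorphic_on UNIV" "\<forall>\<^sub>\<approx>x\<in>UNIV. f x \<noteq> 0"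
    and S: "S > 0" "\<And>x. norm x = S \<Longrightarrow> f analytic_on {x} \<and> f x \<noteq> 0"
  obtains g where "g holomorphic_on ball 0 (S / 2)"
    "\<And>x. x \<in> ball 0 (S / 2) \<Longrightarrow> norm (g x) \<le> exp (3 * nevanlinna_m f S) * (2 * S) ^ pole_count f S"
    "\<And>x. f analytic_on {x} \<Longrightarrow> g x = f x * pole_poly f S x"
proof -
  define F where "F = (\<lambda>x. f x * pole_poly f S x)"
  define g where "g = remove_sings F"
  define C where "C = exp (3 * nevanlinna_m f S) * (2 * S) ^ pole_count f S"
  have Q_an: "pole_poly f S analytic_on A" for A
    unfolding pole_poly_def by (intro analytic_intros)
  have F_mero: "F meromorphic_on {x}" for x
    unfolding F_def using meromorphic_on_subset[OF f(1), of "{x}"] analytic_on_imp_meromorphic_on[OF Q_an]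
    by (intro meromorphic_intros) auto
  have F_le: "\<forall>\<^sub>F w in at x. norm (F w) \<le> C" if x: "x \<in> ball 0 (S / 2)" for x
  proof -
    have "\<forall>\<^sub>F w in at x. w \<in> ball 0 (S / 2)"
      using x by (intro eventually_at_in_open') auto
    moreover have "\<forall>\<^sub>F w in at x. f analytic_on {w} \<and> f w \<noteq> 0"
      using regular_cosparse[OF f] by (rule eventually_cosparse_imp_eventually_at) auto
    ultimately show ?thesis
    proof eventually_elim
      case (elim w)
      have "norm (F w) \<le> exp ((S + norm w) / (S - norm w) * nevanlinna_m f S) * (2 * S) ^ pole_count f S"
        unfolding F_def using elim S by (intro norm_mult_pole_poly_le f S(2)) auto
      also have "(S + norm w) / (S - norm w) * nevanlinna_m f S \<le> 3 * nevanlinna_m f S"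
        using elim S nevanlinna_m_nonneg by (intro mult_right_mono) (auto simp: field_simps)
      finally show ?case
        using S by (simp add: C_def mult_right_mono)
    qed
  qed
  have lim: "\<exists>c. F \<midarrow>x\<rightarrow> c" if x: "x \<in> ball 0 (S / 2)" for x
  proof (rule ccontr)
    assume "\<nexists>c. F \<midarrow>x\<rightarrow> c"
    hence "is_pole F x"
      using F_mero[of x] by (auto simp: meromorphic_at_iff not_essential_def)
    hence "\<forall>\<^sub>F w in at x. norm (F w) \<ge> C + 1"
      unfolding is_pole_def filterlim_at_infinity_conv_norm_at_top filterlim_at_top by blast
    hence "\<forall>\<^sub>F w in at x. False"
      using F_le[OF x] by eventually_elim auto
    thus False
      by simp
  qed
  show ?thesis
  proof
    have "g analytic_on ball 0 (S / 2)"
      unfolding g_def using lim F_mero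
      by (subst analytic_on_analytic_at) (metis meromorphic_at_iff remove_sings_analytic_at)
    thus "g holomorphic_on ball 0 (S / 2)"
      by (rule analytic_imp_holomorphic)
    show "norm (g x) \<le> exp (3 * nevanlinna_m f S) * (2 * S) ^ pole_count f S"
      if x: "x \<in> ball 0 (S / 2)" for x
    proof -
      from lim[OF x] obtain c where c: "F \<midarrow>x\<rightarrow> c" ..
      have "norm c \<le> C"
        using tendsto_norm[OF c] F_le[OF x] by (rule tendsto_upperbound) auto
      thus ?thesis
        using c unfolding g_def C_def by (simp add: remove_sings_eqI)
    qed
    show "g x = f x * pole_poly f S x" if "f analytic_on {x}" for x
      using that Q_an remove_sings_at_analytic[of F x] unfolding g_def F_def by (simp add: analytic_on_mult)
  qed
qed

section \<open>Counting poles\<close>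

text \<open>The counting function is a sum of jumps, one at the modulus of each pole, and a jump at
  \<open>norm c\<close> contributes the integral of \<open>1 / t\<close> from \<open>norm c\<close>
  to \<open>r\<close>.\<close>

lemma nevanlinna_N_eq:
  assumes f: "f meromorphic_on UNIV" and r: "r > 0"
  shows "nevanlinna_N f r = (\<Sum>c | c \<in> cball 0 r \<and> is_pole f c \<and> c \<noteq> 0. real (nat (- zorder f c)) * ln (r / norm c))
           + real (pole_count f 0) * ln r"
proof -
  define P where "P = {c. c \<in> cball 0 r \<and> is_pole f c \<and> c \<noteq> 0}"
  have finP: "finite P"
    by (rule finite_subset[OF _ finite_poles[OF f, of r]]) (auto simp: P_def)
  have cnt: "real (pole_count f t) - real (pole_count f 0) = (\<Sum>c\<in>P. if norm c \<le> t then real (nat (- zorder f c)) else 0)"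
    if t: "t \<in> {0..r}" for t
  proof -
    have "pole_count f t = (\<Sum>c\<in>{c. c \<in> cball 0 t \<and> is_pole f c \<and> c \<noteq> 0} \<union> {c. c = 0 \<and> is_pole f c}. nat (- zorder f c))"
      unfolding pole_count_def by (rule sum.cong) (use t in auto)
    also have "\<dots> = (\<Sum>c\<in>{c. c \<in> cball 0 t \<and> is_pole f c \<and> c \<noteq> 0}. nat (- zorder f c)) + (\<Sum>c\<in>{c. c = 0 \<and> is_pole f c}. nat (- zorder f c))"
      by (rule sum.union_disjoint) (auto intro: finite_subset[OF _ finite_poles[OF f, of t]])
    also have "(\<Sum>c\<in>{c. c = 0 \<and> is_pole f c}. nat (- zorder f c)) = pole_count f 0"
      unfolding pole_count_def by (rule sum.cong) auto
    also have "{c. c \<in> cball 0 t \<and> is_pole f c \<and> c \<noteq> 0} = {c\<in>P. norm c \<le> t}"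
      using t by (auto simp: P_def)
    finally show ?thesis
      using finP by (auto simp: sum.inter_filter intro!: sum.cong)
  qed
  have one: "((\<lambda>t. (if norm c \<le> t then real (nat (- zorder f c)) else 0) / t) has_integral
      real (nat (- zorder f c)) * ln (r / norm c)) {0..r}" if c: "c \<in> P" for c
  proof -
    have pos: "t > 0" if "norm c \<le> t" for t
      using c that by (intro less_le_trans[OF _ that]) (simp add: P_def)
    have "((\<lambda>t. real (nat (- zorder f c)) * (1 / t)) has_integral real (nat (- zorder f c)) * (ln r - ln (norm c))) {norm c..r}"
      using c by (intro has_integral_mult_right fundamental_theorem_of_calculus)
        (auto simp: P_def has_real_derivative_iff_has_vector_derivative[symmetric]
          intro!: derivative_eq_intros pos)
    hence "((\<lambda>t. if t \<in> {norm c..r} then real (nat (- zorder f c)) * (1 / t) else 0) has_integral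
        real (nat (- zorder f c)) * (ln r - ln (norm c))) {0..r}"
      by (subst has_integral_restrict) auto
    moreover have "ln r - ln (norm c) = ln (r / norm c)"
      using c r by (simp add: P_def ln_div)
    ultimately have "((\<lambda>t. if t \<in> {norm c..r} then real (nat (- zorder f c)) * (1 / t) else 0) has_integral
        real (nat (- zorder f c)) * ln (r / norm c)) {0..r}"
      by simp
    thus ?thesis
      by (rule has_integral_eq[rotated]) auto
  qed
  have "((\<lambda>t. \<Sum>c\<in>P. (if norm c \<le> t then real (nat (- zorder f c)) else 0) / t) has_integral
      (\<Sum>c\<in>P. real (nat (- zorder f c)) * ln (r / norm c))) {0..r}"
    using finP one by (rule has_integral_sum)
  hence "((\<lambda>t. (real (pole_count f t) - real (pole_count f 0)) / t) has_integral
      (\<Sum>c\<in>P. real (nat (- zorder f c)) * ln (r / norm c))) {0..r}"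
    by (rule has_integral_eq[rotated]) (simp add: cnt sum_divide_distrib)
  thus ?thesis
    unfolding nevanlinna_N_def P_def by (simp add: integral_unique)
qed

text \<open>Since \<open>ln 4 \<ge> 1\<close>, every pole in the smaller disc enters the sum for
  radius \<open>4 * r\<close> with weight at least 1; the pole at 0 does so because
  \<open>r \<ge> 1\<close>. The remaining poles contribute nonnegative terms.\<close>

lemma pole_count_le_nevanlinna_N:
  assumes f: "f meromorphic_on UNIV" and r: "r \<ge> 1"
  shows "real (pole_count f r) \<le> nevanlinna_N f (4 * r)"
proof -
  have ln4: "ln 4 \<ge> (1 :: real)"
    by (subst ln_ge_iff) (use exp_le in auto)
  define P where "P = (\<lambda>r. {c. c \<in> cball 0 r \<and> is_pole f c \<and> c \<noteq> 0})"
  have finP: "finite (P r)" for r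
    by (rule finite_subset[OF _ finite_poles[OF f, of r]]) (auto simp: P_def)
  have "pole_count f r = (\<Sum>c\<in>P r \<union> {c. c = 0 \<and> is_pole f c}. nat (- zorder f c))"
    unfolding pole_count_def by (rule sum.cong) (use r in \<open>auto simp: P_def\<close>)
  also have "\<dots> = (\<Sum>c\<in>P r. nat (- zorder f c)) + (\<Sum>c\<in>{c. c = 0 \<and> is_pole f c}. nat (- zorder f c))"
    by (rule sum.union_disjoint) (use finP in \<open>auto simp: P_def\<close>)
  also have "(\<Sum>c\<in>{c. c = 0 \<and> is_pole f c}. nat (- zorder f c)) = pole_count f 0"
    unfolding pole_count_def by (rule sum.cong) auto
  finally have "real (pole_count f r) = (\<Sum>c\<in>P r. real (nat (- zorder f c)) * 1) + real (pole_count f 0) * 1"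
    by simp
  also have "\<dots> \<le> (\<Sum>c\<in>P r. real (nat (- zorder f c)) * ln (4 * r / norm c)) + real (pole_count f 0) * ln (4 * r)"
  proof (intro add_mono sum_mono mult_left_mono)
    fix c assume c: "c \<in> P r"
    have "4 * norm c \<le> 4 * r"
      using c by (auto simp: P_def)
    hence "4 \<le> 4 * r / norm c"
      using c by (subst pos_le_divide_eq) (auto simp: P_def)
    hence "ln 4 \<le> ln (4 * r / norm c)"
      by (subst ln_le_cancel_iff) auto
    thus "1 \<le> ln (4 * r / norm c)"
      using ln4 by linarith
  next
    have "ln 4 \<le> ln (4 * r)"
      using r by (subst ln_le_cancel_iff) auto
    thus "1 \<le> ln (4 * r)"
      using ln4 by linarith
  qed auto
  also have "(\<Sum>c\<in>P r. real (nat (- zorder f c)) * ln (4 * r / norm c)) \<le> (\<Sum>c\<in>P (4 * r). real (nat (- zorder f c)) * ln (4 * r / norm c))"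
    using r finP by (intro sum_mono2) (auto simp: P_def divide_simps)
  finally show ?thesis
    using nevanlinna_N_eq[OF f, of "4 * r"] r by (simp add: P_def)
qed

lemma nevanlinna_N_nonneg:
  assumes f: "f meromorphic_on UNIV" and r: "r \<ge> 1"
  shows "nevanlinna_N f r \<ge> 0"
  using r by (subst nevanlinna_N_eq[OF f]) (auto intro!: add_nonneg_nonneg sum_nonneg mult_nonneg_nonneg simp: divide_simps)

section \<open>Wilson iterates\<close>

text \<open>One application of the operator takes a difference of two values and divides it by
  \<open>2 * norm z\<close>, so a common bound survives as long as \<open>norm z \<ge> 1\<close>.
  The margin \<open>k / 2\<close> ensures this after all shifts by half units.\<close>

lemma norm_wilson_iterate_le:
  assumes "\<And>j :: int. \<bar>j\<bar> \<le> int k \<Longrightarrow> norm (f ((z + \<i> * of_int j / 2)\<^sup>2)) \<le> B"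
    and "norm z \<ge> real k / 2 + 1"
  shows "norm ((wilson ^^ k) f (z\<^sup>2)) \<le> B"
  using assms
proof (induction k arbitrary: z)
  case 0
  from 0(1)[of 0] show ?case
    by simp
next
  case (Suc k)
  define h where "h = (wilson ^^ k) f"
  have bound: "norm (h ((z + \<i> * of_int s / 2)\<^sup>2)) \<le> B" if s: "\<bar>s\<bar> = 1" for s :: int
    unfolding h_def
  proof (rule Suc.IH)
    fix j :: int assume "\<bar>j\<bar> \<le> int k"
    hence "norm (f ((z + \<i> * of_int (s + j) / 2)\<^sup>2)) \<le> B"
      using s by (intro Suc.prems(1)) auto
    thus "norm (f ((z + \<i> * of_int s / 2 + \<i> * of_int j / 2)\<^sup>2)) \<le> B"
      by (simp add: algebra_simps add_divide_distrib)
  next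
    have "norm (\<i> * of_int s / 2 :: complex) = 1 / 2"
      using s by (simp add: norm_mult norm_divide)
    thus "real k / 2 + 1 \<le> norm (z + \<i> * of_int s / 2)"
      using norm_diff_ineq[of z "\<i> * of_int s / 2"] Suc.prems(2) by (simp add: field_simps)
  qed
  have z: "norm z \<ge> 1"
    using Suc.prems(2) by (simp add: field_simps)
  hence "z \<noteq> 0"
    by auto
  have "norm ((wilson ^^ Suc k) f (z\<^sup>2)) = norm (h ((z + \<i> / 2)\<^sup>2) - h ((z - \<i> / 2)\<^sup>2)) / (2 * norm z)"
    using wilson_eq[of "z\<^sup>2" z h] \<open>z \<noteq> 0\<close> by (simp add: h_def norm_divide norm_mult)
  also have "\<dots> \<le> (B + B) / (2 * norm z)"
    using bound[of 1] bound[of "-1"] norm_triangle_ineq4[of "h ((z + \<i> / 2)\<^sup>2)" "h ((z - \<i> / 2)\<^sup>2)"]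
    by (intro divide_right_mono) auto
  also have "\<dots> \<le> B"
  proof -
    have "B \<ge> 0"
      using bound[of 1] norm_ge_zero order_trans by (metis abs_one)
    hence "B * 1 \<le> B * norm z"
      using z by (intro mult_left_mono)
    thus ?thesis
      using \<open>z \<noteq> 0\<close> by (simp add: divide_simps)
  qed
  finally show ?case .
qed

section \<open>Radii with comparable values\<close>

text \<open>On either side of \<open>c\<close> the distances \<open>\<bar>real k - c\<bar>\<close>
  have distinct integer parts, so each side contributes at most one harmonic sum.\<close>

lemma sum_inverse_dist_le:
  fixes c :: real and N M :: nat
  assumes M: "\<And>k. k < N \<Longrightarrow> \<bar>real k - c\<bar> \<le> real M"
  shows "(\<Sum>k<N. 1 / (1 + \<bar>real k - c\<bar>)) \<le> 2 * harm (Suc M)"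
proof -
  define A where "A = {k \<in> {..<N}. real k \<ge> c}"
  define A' where "A' = {k \<in> {..<N}. real k < c}"
  have floor_le: "real (nat \<lfloor>x\<rfloor>) \<le> x" if "x \<ge> 0" for x :: real
    using that by simp
  have part: "(\<Sum>k\<in>K. 1 / (1 + \<bar>real k - c\<bar>)) \<le> harm (Suc M)"
    if K: "K \<subseteq> {..<N}" and inj: "inj_on (\<lambda>k. nat \<lfloor>\<bar>real k - c\<bar>\<rfloor>) K" for K
  proof -
    have "(\<Sum>k\<in>K. 1 / (1 + \<bar>real k - c\<bar>)) \<le> (\<Sum>k\<in>K. inverse (real (Suc (nat \<lfloor>\<bar>real k - c\<bar>\<rfloor>))))"
    proof (rule sum_mono)
      fix k
      have "real (Suc (nat \<lfloor>\<bar>real k - c\<bar>\<rfloor>)) \<le> 1 + \<bar>real k - c\<bar>"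
        using floor_le[of "\<bar>real k - c\<bar>"] by simp
      thus "1 / (1 + \<bar>real k - c\<bar>) \<le> inverse (real (Suc (nat \<lfloor>\<bar>real k - c\<bar>\<rfloor>)))"
        unfolding inverse_eq_divide by (intro divide_left_mono mult_pos_pos of_nat_0_less_iff[THEN iffD2] add_pos_nonneg) auto
    qed
    also have "\<dots> = (\<Sum>m\<in>(\<lambda>k. nat \<lfloor>\<bar>real k - c\<bar>\<rfloor>) ` K. inverse (real (Suc m)))"
      using inj by (simp add: sum.reindex)
    also have "\<dots> \<le> (\<Sum>m<Suc M. inverse (real (Suc m)))"
    proof (intro sum_mono2)
      show "(\<lambda>k. nat \<lfloor>\<bar>real k - c\<bar>\<rfloor>) ` K \<subseteq> {..<Suc M}"
      proof safe
        fix k assume "k \<in> K"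
        hence "\<lfloor>\<bar>real k - c\<bar>\<rfloor> \<le> \<lfloor>real M\<rfloor>"
          using K M by (intro floor_mono) auto
        thus "nat \<lfloor>\<bar>real k - c\<bar>\<rfloor> < Suc M"
          by simp
      qed
    qed auto
    also have "\<dots> = harm (Suc M)"
      unfolding harm_def by (rule sum.reindex_bij_witness[of _ "\<lambda>k. k - 1" Suc]) auto
    finally show ?thesis .
  qed
  have "(\<Sum>k<N. 1 / (1 + \<bar>real k - c\<bar>)) = (\<Sum>k\<in>A \<union> A'. 1 / (1 + \<bar>real k - c\<bar>))"
    by (rule sum.cong) (auto simp: A_def A'_def)
  also have "\<dots> = (\<Sum>k\<in>A. 1 / (1 + \<bar>real k - c\<bar>)) + (\<Sum>k\<in>A'. 1 / (1 + \<bar>real k - c\<bar>))"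
    by (rule sum.union_disjoint) (auto simp: A_def A'_def)
  also have "\<dots> \<le> harm (Suc M) + harm (Suc M)"
  proof (intro add_mono part)
    have floor_eq: "\<bar>x - y\<bar> < 1" if "nat \<lfloor>x\<rfloor> = nat \<lfloor>y\<rfloor>" "x \<ge> 0" "y \<ge> 0" for x y :: real
      using that by linarith
    show "inj_on (\<lambda>k. nat \<lfloor>\<bar>real k - c\<bar>\<rfloor>) A"
      by (rule inj_onI, drule floor_eq) (auto simp: A_def)
    show "inj_on (\<lambda>k. nat \<lfloor>\<bar>real k - c\<bar>\<rfloor>) A'"
      by (rule inj_onI, drule floor_eq) (auto simp: A'_def)
  qed (auto simp: A_def A'_def)
  also have "\<dots> \<le> 2 * harm (Suc M)"
    using harm_nonneg[of "Suc M", where 'a = real] by simp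
  finally show ?thesis .
qed

lemma harm_Suc_le: "harm (Suc n) \<le> (1 + ln (real n + 1) :: real)"
proof (induction n)
  case (Suc n)
  have "ln (real n + 1) - ln (real n + 2) \<le> (real n + 1 - (real n + 2)) / (real n + 2)"
    by (rule ln_diff_le) auto
  moreover have "(real n + 1 - (real n + 2)) / (real n + 2) = - inverse (real n + 2)"
    by (simp add: field_simps)
  ultimately have "inverse (real n + 2) \<le> ln (real n + 2) - ln (real n + 1)"
    by linarith
  thus ?case
    using Suc by (simp add: harm_Suc[of "Suc n"] add_ac)
qed (simp add: harm_def)

lemma growth_order_less_halfE:
  assumes "growth_order f < 1 / 2"
  obtains \<rho> where "0 < \<rho>" "\<rho> < 1 / 2" "\<forall>\<^sub>F r in at_top. nevanlinna_T f r \<le> r powr \<rho>"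
proof -
  have half: "(1 / 2 :: ereal) = ereal (1 / 2)"
    by (simp add: one_ereal_def numeral_eq_ereal)
  from assms obtain \<sigma> where \<sigma>: "growth_order f < ereal \<sigma>" "ereal \<sigma> < ereal (1 / 2)"
    using ereal_dense2[of "growth_order f" "1 / 2"] unfolding half by auto
  \<comment> \<open>The maximum makes the exponent positive whatever the sign of
    \<open>\<sigma>\<close>, and \<open>1 / 4\<close> still lies below \<open>1 / 2\<close>.\<close>
  define \<rho> where "\<rho> = max \<sigma> (1 / 4)"
  have "\<forall>\<^sub>F r in at_top. ereal (ln_plus (nevanlinna_T f r) / ln r) < ereal \<sigma>"
    using \<sigma>(1) unfolding growth_order_def by (rule Limsup_lessD)
  hence "\<forall>\<^sub>F r in at_top. nevanlinna_T f r \<le> r powr \<rho>"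
    using eventually_gt_at_top[of 1]
  proof eventually_elim
    case (elim r)
    hence "ln_plus (nevanlinna_T f r) < \<sigma> * ln r"
      by (simp add: divide_simps)
    also have "\<dots> \<le> \<rho> * ln r"
      using elim by (intro mult_right_mono) (auto simp: \<rho>_def)
    finally have "exp (ln_plus (nevanlinna_T f r)) \<le> exp (\<rho> * ln r)"
      by simp
    moreover have "exp (ln_plus (nevanlinna_T f r)) = max 1 (nevanlinna_T f r)"
      by (simp add: ln_plus_def)
    ultimately show ?case
      using elim by (simp add: powr_def)
  qed
  thus ?thesis
    using that[of \<rho>] \<sigma>(2) by (auto simp: \<rho>_def)
qed

text \<open>Up to logarithms the left-hand side grows like \<open>N powr (2 * \<rho>)\<close>, and
  \<open>2 * \<rho> < 1\<close>: this is where the order below \<open>1 / 2\<close> enters. It will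
  bound a sum of \<open>N\<close> terms, one of which must then be below 8.\<close>

lemma asymptotic_budget:
  fixes A \<rho> c d :: real
  assumes "A > 0" "0 < \<rho>" "\<rho> < 1 / 2"
  shows "\<forall>\<^sub>F N in sequentially. 3 * (300 * (A * real N)\<^sup>2) powr \<rho>
      + (1200 * (A * real N)\<^sup>2) powr \<rho> * (ln (600 * (A * real N)\<^sup>2) + d + 24 * (1 + ln (5 * real N + 1))) + c < 8 * real N"
proof -
  have "filterlim (\<lambda>N. 8 * N - (3 * (300 * (A * N)\<^sup>2) powr \<rho>
      + (1200 * (A * N)\<^sup>2) powr \<rho> * (ln (600 * (A * N)\<^sup>2) + d + 24 * (1 + ln (5 * N + 1))) + c)) at_top at_top"
    using assms by real_asymp
  hence "\<forall>\<^sub>F N in at_top. 8 * N - (3 * (300 * (A * N)\<^sup>2) powr \<rho>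
      + (1200 * (A * N)\<^sup>2) powr \<rho> * (ln (600 * (A * N)\<^sup>2) + d + 24 * (1 + ln (5 * N + 1))) + c) > 0"
    unfolding filterlim_at_top_dense by blast
  hence "\<forall>\<^sub>F N in at_top. 3 * (300 * (A * N)\<^sup>2) powr \<rho>
      + (1200 * (A * N)\<^sup>2) powr \<rho> * (ln (600 * (A * N)\<^sup>2) + d + 24 * (1 + ln (5 * N + 1))) + c < 8 * N"
    by eventually_elim linarith
  thus ?thesis
    by (rule eventually_compose_filterlim[OF _ filterlim_real_sequentially])
qed

text \<open>A sparse set is countable, so the moduli of its points cannot fill an interval.\<close>

lemma regular_radius:
  fixes a b :: real
  assumes "\<forall>\<^sub>\<approx>x\<in>UNIV. P (x :: complex)" and "a < b"
  obtains S where "a < S" "S < b" "\<And>x. norm x = S \<Longrightarrow> P x"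
proof -
  have "countable {x. \<not> P x}"
    using sparse_imp_countable[of UNIV "{x. \<not> P x}"] assms(1) by (simp add: eventually_cosparse)
  hence "countable (norm ` {x. \<not> P x})"
    by (rule countable_image)
  moreover have "uncountable {a<..<b}"
    using assms(2) by (simp add: uncountable_open_interval)
  ultimately have "\<not> {a<..<b} \<subseteq> norm ` {x. \<not> P x}"
    using countable_subset by blast
  then obtain S where "S \<in> {a<..<b}" "S \<notin> norm ` {x. \<not> P x}"
    by blast
  thus ?thesis
    using that[of S] by auto
qed

text \<open>The map takes its value at \<open>z0\<close> only at \<open>z0\<close> and
  \<open>- z0 - 2 * a\<close>, so it sends small punctured neighbourhoods into punctured
  neighbourhoods. Properties valid off a sparse set in \<open>x\<close> thus become available at
  points near \<open>z0\<close> after substituting a shifted square.\<close>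

lemma eventually_shift_square:
  assumes "\<forall>\<^sub>\<approx>x\<in>UNIV. P (x :: complex)"
  shows "\<forall>\<^sub>F z in at z0. P ((z + a)\<^sup>2)"
proof -
  have "\<forall>\<^sub>F z in at z0. (z + a)\<^sup>2 \<noteq> (z0 + a)\<^sup>2"
    using eventually_neq_at_within[of z0 z0 UNIV] eventually_neq_at_within[of "- z0 - 2 * a" z0 UNIV]
  proof eventually_elim
    case (elim z)
    have "z + a \<noteq> - (z0 + a)"
    proof
      assume "z + a = - (z0 + a)"
      hence "z = - z0 - 2 * a"
        by algebra
      with elim(2) show False ..
    qed
    thus ?case
      using elim(1) by (simp add: power2_eq_iff)
  qed
  moreover have "(\<lambda>z. (z + a)\<^sup>2) \<midarrow>z0\<rightarrow> (z0 + a)\<^sup>2"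
    by (intro tendsto_intros)
  ultimately have "filterlim (\<lambda>z. (z + a)\<^sup>2) (at ((z0 + a)\<^sup>2)) (at z0)"
    by (auto simp: filterlim_at)
  moreover have "\<forall>\<^sub>F x in at ((z0 + a)\<^sup>2). P x"
    using assms by (rule eventually_cosparse_imp_eventually_at) auto
  ultimately show ?thesis
    by (rule eventually_compose_filterlim[rotated])
qed

lemma maximum_on_sphere:
  assumes g: "g holomorphic_on ball 0 R" and r: "0 \<le> r" "r < R"
  obtains x where "norm x = r" "\<And>y. norm y \<le> r \<Longrightarrow> norm (g y) \<le> norm (g (x :: complex))"
proof -
  have cont: "continuous_on (ball 0 R) g"
    using g by (rule holomorphic_on_imp_continuous_on)
  have "of_real r \<in> sphere (0 :: complex) r"
    using r by simp
  moreover have "continuous_on (sphere 0 r) (\<lambda>x. norm (g x))"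
    using r by (intro continuous_on_norm continuous_on_subset[OF cont]) auto
  ultimately obtain x where x: "x \<in> sphere 0 r" "\<And>y. y \<in> sphere 0 r \<Longrightarrow> norm (g y) \<le> norm (g x)"
    using continuous_attains_sup[OF compact_sphere] by (metis empty_iff)
  have "norm (g y) \<le> norm (g x)" if "norm y \<le> r" for y
  proof (rule maximum_modulus_frontier[of g "cball 0 r"])
    show "g holomorphic_on interior (cball 0 r)"
      using r by (intro holomorphic_on_subset[OF g]) auto
    show "continuous_on (closure (cball 0 r)) g"
      using r by (intro continuous_on_subset[OF cont]) auto
  qed (use that x(2) in auto)
  thus ?thesis
    using that x(1) by auto
qed

text \<open>Here \<open>d\<close> is the distance of \<open>norm z0\<close> from the modulus of the
  square roots of \<open>b\<close>. Factoring the difference of squares of moduli bounds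
  \<open>norm (w\<^sup>2 - b)\<close> below by about \<open>d * norm z0\<close>, while
  \<open>z\<^sup>2 - w\<^sup>2\<close> is at most of size \<open>A * norm z0\<close>; the relative
  change is therefore \<open>O(A / d)\<close>.\<close>

lemma square_diff_ratio_le:
  fixes z w z0 b :: complex and A d :: real
  assumes r: "norm z0 \<ge> 3 * A" "A > 0" and zw: "norm (z - z0) \<le> A" "norm (w - z0) \<le> A"
    and d: "d = \<bar>norm z0 - sqrt (norm b)\<bar>" "d \<ge> 2 * A"
  shows "w\<^sup>2 \<noteq> b" "norm (z\<^sup>2 - b) \<le> exp (16 * A / d) * norm (w\<^sup>2 - b)"
proof -
  define r where "r = norm z0"
  define \<beta> where "\<beta> = sqrt (norm b)"
  have w: "\<bar>norm w - r\<bar> \<le> A"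
    using norm_triangle_ineq3[of w z0] zw(2) by (simp add: r_def)
  \<comment> \<open>Moving from \<open>z0\<close> to \<open>w\<close> costs at most
    \<open>A \<le> d / 2\<close> of the distance \<open>d\<close>.\<close>
  have wb: "\<bar>norm w - \<beta>\<bar> \<ge> d / 2"
  proof -
    have "d \<le> \<bar>norm w - r\<bar> + \<bar>norm w - \<beta>\<bar>"
      using d(1) unfolding r_def \<beta>_def by linarith
    thus ?thesis
      using w d(2) by linarith
  qed
  have "\<beta> \<ge> 0"
    by (simp add: \<beta>_def)
  hence "r - A \<le> norm w + \<beta>"
    using w by linarith
  hence "(d / 2) * (r - A) \<le> \<bar>norm w - \<beta>\<bar> * (norm w + \<beta>)"
    using wb r d by (intro mult_mono) (auto simp: r_def)
  also have "\<dots> = \<bar>(norm w)\<^sup>2 - \<beta>\<^sup>2\<bar>"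
  proof -
    have "(norm w)\<^sup>2 - \<beta>\<^sup>2 = (norm w - \<beta>) * (norm w + \<beta>)"
      by (simp add: power2_eq_square algebra_simps)
    moreover have "norm w + \<beta> \<ge> 0"
      by (simp add: \<beta>_def)
    ultimately show ?thesis
      by (simp only: abs_mult abs_of_nonneg)
  qed
  also have "\<dots> = \<bar>norm (w\<^sup>2) - norm b\<bar>"
    by (simp add: \<beta>_def norm_power)
  also have "\<dots> \<le> norm (w\<^sup>2 - b)"
    by (rule norm_triangle_ineq3)
  finally have low: "(d / 2) * (r - A) \<le> norm (w\<^sup>2 - b)" .
  have pos: "(d / 2) * (r - A) > 0"
    using d r by (intro mult_pos_pos) (auto simp: r_def)
  show "w\<^sup>2 \<noteq> b"
    using low pos by auto
  have "z - w = (z - z0) - (w - z0)" "z + w = 2 * z0 + ((z - z0) + (w - z0))"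
    by simp_all
  hence "norm (z - w) \<le> A + A" "norm (z + w) \<le> 2 * r + (A + A)"
    using zw norm_triangle_ineq4[of "z - z0" "w - z0"] norm_triangle_ineq[of "z - z0" "w - z0"]
      norm_triangle_ineq[of "2 * z0" "(z - z0) + (w - z0)"] by (auto simp: r_def norm_mult)
  hence "norm ((z - w) * (z + w)) \<le> (A + A) * (2 * r + (A + A))"
    unfolding norm_mult using r by (intro mult_mono) auto
  \<comment> \<open>\<open>r \<ge> 3 * A\<close> gives
    \<open>2 * r + 2 * A \<le> 4 * (r - A)\<close>, which matches the factor \<open>r - A\<close> of
    the lower bound.\<close>
  also have "\<dots> \<le> (A + A) * (4 * (r - A))"
    using r by (intro mult_left_mono) (auto simp: r_def)
  also have "\<dots> = (16 * A / d) * ((d / 2) * (r - A))"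
    using d r by (simp add: field_simps)
  also have "\<dots> \<le> (16 * A / d) * norm (w\<^sup>2 - b)"
    using low d r by (intro mult_left_mono) auto
  finally have "norm ((z - w) * (z + w)) \<le> (16 * A / d) * norm (w\<^sup>2 - b)" .
  moreover have "z\<^sup>2 - b = (w\<^sup>2 - b) + (z - w) * (z + w)"
    by (simp add: power2_eq_square algebra_simps)
  ultimately have "norm (z\<^sup>2 - b) \<le> norm (w\<^sup>2 - b) + (16 * A / d) * norm (w\<^sup>2 - b)"
    using norm_triangle_ineq[of "w\<^sup>2 - b" "(z - w) * (z + w)"]
    by (metis add_left_mono order_trans)
  also have "\<dots> = (1 + 16 * A / d) * norm (w\<^sup>2 - b)"
    by (simp add: algebra_simps)
  also have "\<dots> \<le> exp (16 * A / d) * norm (w\<^sup>2 - b)"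
    by (intro mult_right_mono) auto
  finally show "norm (z\<^sup>2 - b) \<le> exp (16 * A / d) * norm (w\<^sup>2 - b)" .
qed

text \<open>\<open>E\<close> stands for a property valid off a sparse set, such as the difference
  equation, that must hold at the chosen point. In the constant, \<open>exp 8\<close> comes from
  averaging over radii, and 2 from moving off a maximum point to a nearby regular point; that move,
  of length below 1, is why the shifts are bounded by \<open>A - 1\<close>.\<close>

lemma slow_growth_comparable_shifts:
  fixes f :: "complex \<Rightarrow> complex" and A \<rho> R :: real and J :: "complex set"
  assumes f: "f meromorphic_on UNIV" "\<forall>\<^sub>\<approx>x\<in>UNIV. f x \<noteq> 0"
    and \<rho>: "0 < \<rho>" "\<rho> < 1 / 2" "\<forall>\<^sub>F r in at_top. nevanlinna_T f r \<le> r powr \<rho>"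
    and J: "finite J" "\<And>a. a \<in> J \<Longrightarrow> norm a \<le> A - 1" "A \<ge> 1"
    and E: "\<forall>\<^sub>\<approx>x\<in>UNIV. E x"
  obtains z where "norm z \<ge> R" "E (z\<^sup>2)" "f (z\<^sup>2) \<noteq> 0"
    "\<And>a. a \<in> J \<Longrightarrow> norm (f ((z + a)\<^sup>2)) \<le> 2 * exp 8 * norm (f (z\<^sup>2))"
proof -

  \<comment> \<open>Base point, scale and cutoff radius\<close>
  obtain r0 where r0: "\<And>r. r \<ge> r0 \<Longrightarrow> nevanlinna_T f r \<le> r powr \<rho>"
    using \<rho>(3) by (auto simp: eventually_at_top_linorder)
  have reg: "\<forall>\<^sub>\<approx>x\<in>UNIV. f analytic_on {x} \<and> f x \<noteq> 0"
    using f by (rule regular_cosparse)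
  obtain x1 where x1: "f analytic_on {x1}" "f x1 \<noteq> 0"
    using eventually_happens[OF reg] by (auto simp: cosparse_eq_bot_iff')
  \<comment> \<open>\<open>x1\<close> anchors a lower bound for the maximum modulus, and
    \<open>\<delta>\<close> keeps it away from all poles. The cap at 1 makes
    \<open>- ln \<delta>\<close> nonnegative.\<close>
  obtain \<delta> where \<delta>: "0 < \<delta>" "\<delta> \<le> 1" "\<And>c. is_pole f c \<Longrightarrow> \<delta> \<le> norm (x1 - c)"
  proof -
    obtain e where e: "e > 0" "f holomorphic_on ball x1 e"
      using x1(1) by (auto simp: analytic_on_def)
    have "e \<le> norm (x1 - c)" if "is_pole f c" for c
    proof (rule ccontr)
      assume "\<not> e \<le> norm (x1 - c)"
      hence "f analytic_on {c}"
        using e by (intro holomorphic_on_imp_analytic_at[OF e(2)]) (auto simp: dist_norm)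
      thus False
        using that analytic_at_imp_no_pole by blast
    qed
    thus ?thesis
      using e by (intro that[of "min e 1"]) (auto simp: min_le_iff_disj)
  qed
  define v where "v = \<bar>ln (norm (f x1))\<bar>"
  have A0: "A > 0"
    using J(3) by simp
  \<comment> \<open>The conditions on \<open>N\<close> give, in order,
    \<open>norm z \<ge> R\<close>, a disc containing \<open>x1\<close>, radii at which the growth
    bound holds, and an average below 8.\<close>
  have "\<forall>\<^sub>F N in sequentially. N \<ge> 1 \<and> real N \<ge> R + 1 \<and> real N \<ge> norm x1 \<and> real N \<ge> r0 \<and>
      3 * (300 * (A * real N)\<^sup>2) powr \<rho>
      + (1200 * (A * real N)\<^sup>2) powr \<rho> * (ln (600 * (A * real N)\<^sup>2) + - ln \<delta> + 24 * (1 + ln (5 * real N + 1))) + v < 8 * real N"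
    by (intro eventually_conj asymptotic_budget A0 \<rho> eventually_ge_at_top
        eventually_compose_filterlim[OF eventually_ge_at_top filterlim_real_sequentially])
  then obtain N where N: "N \<ge> 1" "real N \<ge> R + 1" "real N \<ge> norm x1" "real N \<ge> r0" and
    budget: "3 * (300 * (A * real N)\<^sup>2) powr \<rho>
      + (1200 * (A * real N)\<^sup>2) powr \<rho> * (ln (600 * (A * real N)\<^sup>2) + - ln \<delta> + 24 * (1 + ln (5 * real N + 1))) + v < 8 * real N"
    using eventually_happens'[OF sequentially_bot] by blast
  define L where "L = A * real N"
  have L: "L \<ge> real N" "L \<ge> A" "L \<ge> 1"
    using N(1) J(3) mult_mono[of 1 A 1 "real N"] by (auto simp: L_def mult_le_cancel_right1 mult_le_cancel_left1)
  have L2: "L\<^sup>2 \<ge> L"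
    using L(3) by (simp add: power2_eq_square)
  \<comment> \<open>\<open>S / 2\<close> exceeds \<open>100 * L\<^sup>2\<close>, so it leaves room
    for the squares of all points of modulus up to \<open>9 * L\<close>.\<close>
  obtain S where S: "200 * L\<^sup>2 < S" "S < 300 * L\<^sup>2" "\<And>x. norm x = S \<Longrightarrow> f analytic_on {x} \<and> f x \<noteq> 0"
    using L2 L(3) by (rule_tac regular_radius[OF reg, of "200 * L\<^sup>2" "300 * L\<^sup>2"]) auto
  have S1: "S \<ge> 1" "S \<ge> r0"
    using S L L2 N by linarith+

  \<comment> \<open>Poles in the disc and the numerator \<open>g\<close>\<close>
  define n where "n = pole_count f S"
  define m where "m = (\<lambda>c. nat (- zorder f c))"
  define P where "P = {c. c \<in> cball 0 S \<and> is_pole f c}"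
  have finP: "finite P"
    unfolding P_def using f(1) by (rule finite_poles)
  have n_eq: "n = (\<Sum>c\<in>P. m c)"
    by (simp add: n_def pole_count_def P_def m_def)
  have Q_eq: "pole_poly f S x = (\<Prod>c\<in>P. (x - c) ^ m c)" for x
    by (simp add: pole_poly_def P_def m_def)
  obtain g where g: "g holomorphic_on ball 0 (S / 2)"
    "\<And>x. x \<in> ball 0 (S / 2) \<Longrightarrow> norm (g x) \<le> exp (3 * nevanlinna_m f S) * (2 * S) ^ n"
    "\<And>x. f analytic_on {x} \<Longrightarrow> g x = f x * pole_poly f S x"
  proof (rule clear_poles[OF f _ S(3)])
    show "S > 0"
      using S1 by simp
  qed (use that n_def in blast)+
  have mS: "nevanlinna_m f S \<le> (300 * L\<^sup>2) powr \<rho>"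
  proof -
    have "nevanlinna_m f S \<le> nevanlinna_T f S"
      using nevanlinna_N_nonneg[OF f(1), of S] S1 by (simp add: nevanlinna_T_def)
    also have "\<dots> \<le> S powr \<rho>"
      using r0 S1 by simp
    also have "\<dots> \<le> (300 * L\<^sup>2) powr \<rho>"
      using S S1 \<rho> by (intro powr_mono2) auto
    finally show ?thesis .
  qed
  have nS: "real n \<le> (1200 * L\<^sup>2) powr \<rho>"
  proof -
    have "real n \<le> nevanlinna_N f (4 * S)"
      unfolding n_def using S1 by (intro pole_count_le_nevanlinna_N f(1))
    also have "\<dots> \<le> nevanlinna_T f (4 * S)"
      using nevanlinna_m_nonneg by (simp add: nevanlinna_T_def)
    also have "\<dots> \<le> (4 * S) powr \<rho>"
      using r0 S1 by simp
    also have "\<dots> \<le> (1200 * L\<^sup>2) powr \<rho>"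
      using S S1 \<rho> by (intro powr_mono2) auto
    finally show ?thesis .
  qed

  \<comment> \<open>The maximum modulus of \<open>g (z\<^sup>2)\<close>\<close>
  have sq_less: "r\<^sup>2 < S / 2" if "0 \<le> r" "r \<le> 9 * L" for r
  proof -
    have "r\<^sup>2 \<le> (9 * L)\<^sup>2"
      using that by (intro power_mono)
    also have "\<dots> = 81 * L\<^sup>2"
      by (simp add: power_mult_distrib)
    also have "\<dots> < S / 2"
      using S(1) L(3) L2 by linarith
    finally show ?thesis .
  qed
  have "\<exists>x. norm x = r\<^sup>2 \<and> (\<forall>y. norm y \<le> r\<^sup>2 \<longrightarrow> norm (g y) \<le> norm (g x))" if "0 \<le> r" "r \<le> 9 * L" for r
    using maximum_on_sphere[OF g(1) _ sq_less[OF that]] by (metis zero_le_power2)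
  then obtain X where X: "\<And>r. 0 \<le> r \<Longrightarrow> r \<le> 9 * L \<Longrightarrow> norm (X r) = r\<^sup>2"
    "\<And>r y. 0 \<le> r \<Longrightarrow> r \<le> 9 * L \<Longrightarrow> norm y \<le> r\<^sup>2 \<Longrightarrow> norm (g y) \<le> norm (g (X r))"
    by metis
  \<comment> \<open>Squaring maps the disc of radius \<open>r\<close> onto that of radius
    \<open>r\<^sup>2\<close>, so \<open>M r\<close> is the maximum of
    \<open>norm (g (z\<^sup>2))\<close> over \<open>norm z \<le> r\<close>.\<close>
  define M where "M = (\<lambda>r. norm (g (X r)))"
  define \<Phi> where "\<Phi> = (\<lambda>r. ln (M r))"
  have M_mono: "M r \<le> M s" if "0 \<le> r" "r \<le> s" "s \<le> 9 * L" for r s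
    unfolding M_def using that X(1)[of r] by (intro X(2)) (auto intro: power_mono)
  \<comment> \<open>The pole polynomial is monic with \<open>n\<close> roots, counted with
    multiplicity, all at distance at least \<open>\<delta>\<close> from \<open>x1\<close>.\<close>
  have g_x1: "norm (g x1) \<ge> norm (f x1) * \<delta> ^ n"
  proof -
    have "\<delta> ^ n = (\<Prod>c\<in>P. \<delta> ^ m c)"
      by (simp add: n_eq power_sum)
    also have "\<dots> \<le> norm (pole_poly f S x1)"
      unfolding Q_eq prod_norm[symmetric] norm_power
      using \<delta> by (intro prod_mono conjI power_mono) (auto simp: P_def)
    finally show ?thesis
      using g(3)[OF x1(1)] by (simp add: norm_mult mult_left_mono)
  qed
  have M_low: "norm (f x1) * \<delta> ^ n \<le> M r" if "4 * L \<le> r" "r \<le> 9 * L" for r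
  proof -
    have "norm x1 \<le> L"
      using N L by linarith
    also have "\<dots> \<le> r"
      using that L by linarith
    also have "\<dots> \<le> r\<^sup>2"
      using that L by (simp add: power2_eq_square)
    finally show ?thesis
      using g_x1 X(2)[of r x1] that L unfolding M_def by linarith
  qed
  have M_pos: "M r > 0" if "4 * L \<le> r" "r \<le> 9 * L" for r
    using M_low[OF that] x1(2) \<delta>(1) by (smt (verit) zero_less_mult_iff zero_less_norm_iff zero_less_power)
  have \<Phi>_mono: "\<Phi> r \<le> \<Phi> s" if "4 * L \<le> r" "r \<le> s" "s \<le> 9 * L" for r s
    unfolding \<Phi>_def using M_mono[of r s] M_pos[of r] M_pos[of s] that L by simp
  have \<Phi>_low: "\<Phi> r \<ge> - v + real n * ln \<delta>" if "4 * L \<le> r" "r \<le> 9 * L" for r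
  proof -
    have "- v + real n * ln \<delta> \<le> ln (norm (f x1)) + real n * ln \<delta>"
      by (simp add: v_def)
    also have "\<dots> = ln (norm (f x1) * \<delta> ^ n)"
      using x1(2) \<delta>(1) by (simp add: ln_mult ln_realpow)
    also have "\<dots> \<le> \<Phi> r"
      unfolding \<Phi>_def using M_low[OF that] M_pos[OF that] x1(2) \<delta>(1) by (subst ln_le_cancel_iff) auto
    finally show ?thesis .
  qed
  have \<Phi>_up: "\<Phi> r \<le> 3 * (300 * L\<^sup>2) powr \<rho> + real n * ln (600 * L\<^sup>2)" if "4 * L \<le> r" "r \<le> 9 * L" for r
  proof -
    have r: "0 \<le> r"
      using that L by linarith
    have "M r \<le> exp (3 * nevanlinna_m f S) * (2 * S) ^ n"
      unfolding M_def using X(1)[OF r that(2)] sq_less[OF r that(2)] by (intro g(2)) auto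
    hence "\<Phi> r \<le> ln (exp (3 * nevanlinna_m f S) * (2 * S) ^ n)"
      unfolding \<Phi>_def using M_pos[OF that] S1 by (subst ln_le_cancel_iff) auto
    also have "\<dots> = 3 * nevanlinna_m f S + real n * ln (2 * S)"
      using S1 by (simp add: ln_mult ln_realpow algebra_simps)
    also have "\<dots> \<le> 3 * (300 * L\<^sup>2) powr \<rho> + real n * ln (600 * L\<^sup>2)"
      using mS S S1 L by (intro add_mono mult_left_mono) auto
    finally show ?thesis .
  qed
  \<comment> \<open>Among the radii \<open>rk k\<close>, one has both a small increment of \<open>\<Phi>\<close> and little influence of
    the poles: the increments telescope, and each pole contributes \<open>O(ln N)\<close> to the sum over \<open>k\<close>.
    Here \<open>4 * A * u k c\<close> is the distance of \<open>rk k\<close> from the modulus of the square roots of \<open>c\<close>;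
    a term with \<open>u k c \<le> 1/2\<close> alone makes \<open>s k \<ge> 8\<close>.\<close>
  define rk where "rk = (\<lambda>k::nat. 4 * A * (real N + real k))"
  define u where "u = (\<lambda>(k::nat) (c::complex). \<bar>real k - (sqrt (norm c) / (4 * A) - real N)\<bar>)"
  define s where "s = (\<lambda>k. (\<Phi> (rk k + A) - \<Phi> (rk k)) + (\<Sum>c\<in>P. real (m c) * (12 / (1 + u k c))))"
  have rk_bd: "4 * L \<le> rk k" "rk k + A \<le> 9 * L" "rk k + A \<le> rk (Suc k)" if "k < N" for k
  proof -
    have "rk k = 4 * L + 4 * (A * real k)" "rk (Suc k) = 4 * L + 4 * (A * real k) + 4 * A"
      by (simp_all add: rk_def L_def algebra_simps)
    moreover have "A * real k \<ge> 0" "A * real k + A \<le> L"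
      using A0 mult_left_mono[of "real k + 1" "real N" A] that by (auto simp: L_def algebra_simps)
    ultimately show "4 * L \<le> rk k" "rk k + A \<le> 9 * L" "rk k + A \<le> rk (Suc k)"
      using A0 L by linarith+
  qed
  have "(\<Sum>k<N. \<Phi> (rk k + A) - \<Phi> (rk k)) \<le> \<Phi> (8 * L) - \<Phi> (4 * L)"
  proof -
    \<comment> \<open>The radii are spaced by \<open>4 * A\<close>, so by monotonicity each
      increment may be extended to the next radius.\<close>
    have "(\<Sum>k<N. \<Phi> (rk k + A) - \<Phi> (rk k)) \<le> (\<Sum>k<N. \<Phi> (rk (Suc k)) - \<Phi> (rk k))"
    proof (intro sum_mono diff_right_mono \<Phi>_mono)
      fix k assume "k \<in> {..<N}"
      hence k: "k < N"
        by simp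
      have "rk (Suc k) \<le> 8 * L"
        using k A0 mult_left_mono[of "real (Suc k)" "real N" A] by (simp add: rk_def L_def algebra_simps)
      thus "rk (Suc k) \<le> 9 * L"
        using L by linarith
      show "4 * L \<le> rk k + A" "rk k + A \<le> rk (Suc k)"
        using rk_bd[OF k] A0 by linarith+
    qed
    also have "\<dots> = \<Phi> (rk N) - \<Phi> (rk 0)"
      by (rule sum_lessThan_telescope)
    also have "rk N = 8 * L"
      by (simp add: rk_def L_def)
    also have "rk 0 = 4 * L"
      by (simp add: rk_def L_def)
    finally show ?thesis .
  qed
  also have "\<dots> \<le> 3 * (300 * L\<^sup>2) powr \<rho> + real n * ln (600 * L\<^sup>2) + v - real n * ln \<delta>"
    using \<Phi>_up[of "8 * L"] \<Phi>_low[of "4 * L"] L by simp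
  finally have sum1: "(\<Sum>k<N. \<Phi> (rk k + A) - \<Phi> (rk k)) \<le> 3 * (300 * L\<^sup>2) powr \<rho> + real n * ln (600 * L\<^sup>2) + v - real n * ln \<delta>" .
  have "(\<Sum>k<N. \<Sum>c\<in>P. real (m c) * (12 / (1 + u k c))) = (\<Sum>c\<in>P. real (m c) * 12 * (\<Sum>k<N. 1 / (1 + u k c)))"
    by (subst sum.swap) (simp add: sum_distrib_left)
  also have "\<dots> \<le> (\<Sum>c\<in>P. real (m c) * 12 * (2 * (1 + ln (5 * real N + 1))))"
  proof (intro sum_mono mult_left_mono)
    fix c assume c: "c \<in> P"
    \<comment> \<open>\<open>S < 300 * L\<^sup>2 < (18 * L)\<^sup>2\<close>, so in units of
      \<open>4 * A\<close> the square roots of the poles have modulus at most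
      \<open>4.5 * N\<close>, and all distances \<open>u k c\<close> stay below
      \<open>5 * N\<close>.\<close>
    have "sqrt (norm c) \<le> sqrt S"
      using c by (simp add: P_def)
    also have "\<dots> \<le> sqrt ((18 * L)\<^sup>2)"
      using S L by (subst real_sqrt_le_iff) (auto simp: power_mult_distrib)
    also have "\<dots> = 18 * L"
      using L by (subst real_sqrt_unique[OF refl]) auto
    finally have "sqrt (norm c) / (4 * A) \<le> 18 / 4 * real N"
      using A0 by (simp add: L_def divide_simps mult_ac)
    moreover have "sqrt (norm c) / (4 * A) \<ge> 0"
      using A0 by simp
    ultimately have "u k c \<le> real (5 * N)" if "k < N" for k
      using that by (simp add: u_def abs_le_iff)
    hence "(\<Sum>k<N. 1 / (1 + u k c)) \<le> 2 * harm (Suc (5 * N))"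
      unfolding u_def by (rule sum_inverse_dist_le)
    also have "\<dots> \<le> 2 * (1 + ln (5 * real N + 1))"
      using harm_Suc_le[of "5 * N"] by simp
    finally show "(\<Sum>k<N. 1 / (1 + u k c)) \<le> 2 * (1 + ln (5 * real N + 1))" .
  qed auto
  also have "\<dots> = real n * (24 * (1 + ln (5 * real N + 1)))"
    by (simp add: n_eq sum_distrib_right algebra_simps sum.distrib)
  finally have sum2: "(\<Sum>k<N. \<Sum>c\<in>P. real (m c) * (12 / (1 + u k c))) \<le> real n * (24 * (1 + ln (5 * real N + 1)))" .
  have "(\<Sum>k<N. s k) = (\<Sum>k<N. \<Phi> (rk k + A) - \<Phi> (rk k)) + (\<Sum>k<N. \<Sum>c\<in>P. real (m c) * (12 / (1 + u k c)))"
    by (simp only: s_def sum.distrib)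
  moreover have "real n * (ln (600 * L\<^sup>2) + - ln \<delta> + 24 * (1 + ln (5 * real N + 1))) =
      real n * ln (600 * L\<^sup>2) - real n * ln \<delta> + real n * (24 * (1 + ln (5 * real N + 1)))"
    by (simp add: algebra_simps)
  ultimately have "(\<Sum>k<N. s k) \<le> 3 * (300 * L\<^sup>2) powr \<rho> + real n * (ln (600 * L\<^sup>2) + - ln \<delta> + 24 * (1 + ln (5 * real N + 1))) + v"
    using sum1 sum2 by linarith
  also have "\<dots> \<le> 3 * (300 * L\<^sup>2) powr \<rho> + (1200 * L\<^sup>2) powr \<rho> * (ln (600 * L\<^sup>2) + - ln \<delta> + 24 * (1 + ln (5 * real N + 1))) + v"
  proof -
    have "ln (600 * L\<^sup>2) \<ge> 0" "- ln \<delta> \<ge> 0" "ln (5 * real N + 1) \<ge> 0"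
      using L L2 \<delta> N by (auto intro!: ln_ge_zero)
    thus ?thesis
      using nS by (intro add_mono mult_right_mono) auto
  qed
  also have "\<dots> < (\<Sum>k<N. 8)"
    using budget by (simp add: L_def)
  \<comment> \<open>A sum of \<open>N\<close> terms below \<open>8 * N\<close> has a term below
    8.\<close>
  finally obtain k where k: "k < N" "s k < 8"
    by (metis lessThan_iff not_le sum_mono)

  \<comment> \<open>The comparison point near a maximum\<close>
  define r where "r = rk k"
  \<comment> \<open>Either square root of the maximum point \<open>X r\<close> maximises
    \<open>norm (g (z\<^sup>2))\<close> over \<open>norm z \<le> r\<close>.\<close>
  define z0 where "z0 = csqrt (X r)"
  have r_bd: "4 * L \<le> r" "r + A \<le> 9 * L" "0 \<le> r" "r \<le> 9 * L"
    using rk_bd[OF k(1)] A0 L by (auto simp: r_def)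
  have z0_sq: "z0\<^sup>2 = X r"
    by (simp add: z0_def)
  have norm_z0: "norm z0 = r"
    using X(1)[OF r_bd(3,4)] r_bd(3) by (simp add: z0_def)
  define W where "W = (\<Sum>c\<in>P. real (m c) * (12 / (1 + u k c)))"
  have u_nonneg: "u k c \<ge> 0" for c
    by (simp add: u_def)
  have term_nonneg: "real (m c) * (12 / (1 + u k c)) \<ge> 0" for c
    using u_nonneg by (intro mult_nonneg_nonneg divide_nonneg_nonneg) auto
  have \<Phi>_inc: "\<Phi> r \<le> \<Phi> (r + A)"
    using r_bd A0 by (intro \<Phi>_mono) auto
  have sk: "\<Phi> (r + A) - \<Phi> r + W < 8"
    using k(2) by (simp add: s_def r_def W_def)
  have u_half: "u k c > 1 / 2" if c: "c \<in> P" for c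
  proof -
    have "m c \<ge> 1"
    proof -
      have "isolated_singularity_at f c"
        using f(1) by (auto simp: meromorphic_on_altdef)
      hence "zorder f c < 0"
        using c by (intro isolated_pole_imp_neg_zorder) (auto simp: P_def)
      thus ?thesis
        by (simp add: m_def)
    qed
    hence "1 * (12 / (1 + u k c)) \<le> real (m c) * (12 / (1 + u k c))"
      using u_nonneg[of c] by (intro mult_right_mono) auto
    also have "\<dots> \<le> W"
      unfolding W_def using c finP term_nonneg by (intro member_le_sum) auto
    also have "\<dots> < 8"
      using sk \<Phi>_inc by linarith
    finally show ?thesis
      using u_nonneg[of c] by (simp add: divide_simps split: if_splits)
  qed
  have Q_ratio: "pole_poly f S (w\<^sup>2) \<noteq> 0" "norm (pole_poly f S (z\<^sup>2)) \<le> exp W * norm (pole_poly f S (w\<^sup>2))"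
    if zw: "norm (z - z0) \<le> A" "norm (w - z0) \<le> A" for z w
  proof -
    have factor: "w\<^sup>2 \<noteq> c" "norm (z\<^sup>2 - c) \<le> exp (12 / (1 + u k c)) * norm (w\<^sup>2 - c)" if c: "c \<in> P" for c
    proof -
      define d where "d = \<bar>norm z0 - sqrt (norm c)\<bar>"
      have "d = \<bar>4 * A * (real k - (sqrt (norm c) / (4 * A) - real N))\<bar>"
        using A0 by (simp add: d_def norm_z0 r_def rk_def algebra_simps)
      hence d: "d = 4 * A * u k c"
        using A0 by (simp add: abs_mult u_def)
      have z0_ge: "norm z0 \<ge> 3 * A"
        using r_bd(1) L A0 unfolding norm_z0 by linarith
      have d_ge: "d \<ge> 2 * A"
        using mult_left_mono[OF less_imp_le[OF u_half[OF c]], of "4 * A"] A0 by (simp add: d)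
      note bound = square_diff_ratio_le[OF z0_ge A0 zw d_def d_ge]
      show "w\<^sup>2 \<noteq> c"
        by (rule bound(1))
      \<comment> \<open>The inequality \<open>4 / u \<le> 12 / (1 + u)\<close> amounts to
        \<open>u \<ge> 1 / 2\<close>; this explains the constant 12 in \<open>s\<close>.\<close>
      have "16 * A / d = 4 / u k c"
        using A0 by (simp add: d)
      also have "\<dots> \<le> 12 / (1 + u k c)"
        using u_half[OF c] by (simp add: divide_simps)
      finally have "exp (16 * A / d) \<le> exp (12 / (1 + u k c))"
        by simp
      thus "norm (z\<^sup>2 - c) \<le> exp (12 / (1 + u k c)) * norm (w\<^sup>2 - c)"
        using bound(2) by (meson mult_right_mono norm_ge_zero order_trans)
    qed
    show "pole_poly f S (w\<^sup>2) \<noteq> 0"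
      unfolding Q_eq using factor(1) finP by auto
    have "norm (pole_poly f S (z\<^sup>2)) = (\<Prod>c\<in>P. norm (z\<^sup>2 - c) ^ m c)"
      by (simp add: Q_eq prod_norm[symmetric] norm_power)
    also have "\<dots> \<le> (\<Prod>c\<in>P. (exp (12 / (1 + u k c)) * norm (w\<^sup>2 - c)) ^ m c)"
      using factor(2) by (intro prod_mono conjI power_mono) auto
    also have "\<dots> = (\<Prod>c\<in>P. exp (real (m c) * (12 / (1 + u k c)))) * (\<Prod>c\<in>P. norm (w\<^sup>2 - c) ^ m c)"
      by (simp only: power_mult_distrib prod.distrib exp_of_nat_mult)
    also have "\<dots> = exp W * norm (pole_poly f S (w\<^sup>2))"
      by (simp add: Q_eq prod_norm[symmetric] norm_power W_def exp_sum finP)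
    finally show "norm (pole_poly f S (z\<^sup>2)) \<le> exp W * norm (pole_poly f S (w\<^sup>2))" .
  qed
  have "isCont g (z0\<^sup>2)"
  proof (rule continuous_on_interior)
    show "continuous_on (ball 0 (S / 2)) g"
      using g(1) by (rule holomorphic_on_imp_continuous_on)
    show "z0\<^sup>2 \<in> interior (ball 0 (S / 2))"
      using sq_less[OF r_bd(3,4)] norm_z0 by (simp add: norm_power)
  qed
  hence "((\<lambda>z. norm (g (z\<^sup>2))) \<longlongrightarrow> M r) (at z0)"
    unfolding M_def z0_sq[symmetric] by (intro tendsto_intros isCont_tendsto_compose[of "z0\<^sup>2" g])
  \<comment> \<open>At \<open>z0\<close> itself \<open>f\<close> may be singular or \<open>E\<close>
    may fail. A nearby \<open>z\<close> avoids this and loses at most a factor 2 of the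
    maximum.\<close>
  hence "\<forall>\<^sub>F z in at z0. M r / 2 < norm (g (z\<^sup>2))"
    using M_pos[OF r_bd(1,4)] by (rule_tac order_tendstoD(1)) auto
  moreover have "\<forall>\<^sub>F z in at z0. norm (z - z0) < 1"
    using eventually_at_ball[of 1 z0 UNIV] by (simp add: dist_norm norm_minus_commute)
  moreover have "\<forall>\<^sub>F z in at z0. E ((z + 0)\<^sup>2)"
    using E by (rule eventually_shift_square)
  moreover have "\<forall>\<^sub>F z in at z0. \<forall>a\<in>insert 0 J. f analytic_on {(z + a)\<^sup>2}"
    using J(1) eventually_shift_square[OF meromorphic_on_imp_analytic_cosparse[OF f(1)]]
    by (intro eventually_ball_finite) auto
  ultimately have "\<forall>\<^sub>F z in at z0. M r / 2 < norm (g (z\<^sup>2)) \<and> norm (z - z0) < 1 \<and> E ((z + 0)\<^sup>2) \<and>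
      (\<forall>a\<in>insert 0 J. f analytic_on {(z + a)\<^sup>2})"
    by eventually_elim auto
  then obtain z where z: "M r / 2 < norm (g (z\<^sup>2))" "norm (z - z0) < 1" "E (z\<^sup>2)"
    "\<And>a. a \<in> insert 0 J \<Longrightarrow> f analytic_on {(z + a)\<^sup>2}"
    using eventually_happens'[OF at_neq_bot] by fastforce
  have gz: "g (z\<^sup>2) = f (z\<^sup>2) * pole_poly f S (z\<^sup>2)"
    using g(3) z(4)[of 0] by simp
  show ?thesis
  proof (rule that[of z])
    have "norm z0 \<le> norm z + norm (z - z0)"
      using norm_triangle_sub[of z0 z] by (simp add: norm_minus_commute)
    thus "R \<le> norm z"
      using N(2) L(1,3) r_bd(1) z(2) unfolding norm_z0 by linarith
    show "E (z\<^sup>2)"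
      by fact
    show "f (z\<^sup>2) \<noteq> 0"
      using z(1) gz M_pos[OF r_bd(1,4)] by auto
    fix a assume a: "a \<in> J"
    define w where "w = z + a"
    have w_z0: "norm (w - z0) \<le> A"
      using norm_triangle_ineq[of "z - z0" a] J(2)[OF a] z(2) by (simp add: w_def algebra_simps)
    have z_z0: "norm (z - z0) \<le> A"
      using z(2) J(3) by linarith
    have gw: "g (w\<^sup>2) = f (w\<^sup>2) * pole_poly f S (w\<^sup>2)"
      using g(3) z(4)[of a] a by (simp add: w_def)
    have "norm w \<le> r + A"
      using norm_triangle_sub[of w z0] w_z0 norm_z0 by linarith
    hence "norm (w\<^sup>2) \<le> (r + A)\<^sup>2"
      by (simp add: norm_power power_mono)
    \<comment> \<open>From here the increment of \<open>\<Phi>\<close> leads back to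
      \<open>M r\<close>, hence to \<open>g (z\<^sup>2)\<close>. The ratio bound then replaces the
      pole polynomial at \<open>z\<^sup>2\<close> by its nonzero value at \<open>w\<^sup>2\<close>,
      which cancels.\<close>
    hence "norm (g (w\<^sup>2)) \<le> M (r + A)"
      unfolding M_def using r_bd A0 by (intro X(2)) auto
    also have "M (r + A) = exp (\<Phi> (r + A) - \<Phi> r) * M r"
      using M_pos[of r] M_pos[of "r + A"] r_bd A0 by (simp add: \<Phi>_def exp_diff)
    also have "\<dots> \<le> exp (\<Phi> (r + A) - \<Phi> r) * (2 * norm (g (z\<^sup>2)))"
      using z(1) by (intro mult_left_mono) auto
    also have "norm (g (z\<^sup>2)) \<le> norm (f (z\<^sup>2)) * (exp W * norm (pole_poly f S (w\<^sup>2)))"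
      unfolding gz norm_mult using Q_ratio(2)[OF z_z0 w_z0] by (intro mult_left_mono) auto
    finally have "norm (f (w\<^sup>2)) * norm (pole_poly f S (w\<^sup>2)) \<le>
        (2 * exp (\<Phi> (r + A) - \<Phi> r + W) * norm (f (z\<^sup>2))) * norm (pole_poly f S (w\<^sup>2))"
      by (simp add: gw norm_mult exp_add mult_ac)
    hence "norm (f (w\<^sup>2)) \<le> 2 * exp (\<Phi> (r + A) - \<Phi> r + W) * norm (f (z\<^sup>2))"
      using Q_ratio(1)[OF z_z0 w_z0] by (simp add: mult_le_cancel_right)
    also have "\<dots> \<le> 2 * exp 8 * norm (f (z\<^sup>2))"
      using sk by (intro mult_right_mono mult_left_mono) auto
    finally show "norm (f ((z + a)\<^sup>2)) \<le> 2 * exp 8 * norm (f (z\<^sup>2))"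
      by (simp add: w_def)
  qed
qed

section \<open>The order of solutions\<close>

theorem theorem7p6:
  fixes n :: nat and p :: "nat \<Rightarrow> complex poly" and f :: "complex \<Rightarrow> complex"
  assumes "n \<ge> 1"
    and "p 0 \<noteq> 0"
    and "\<And>k. k \<in> {1..n} \<Longrightarrow> p k = 0 \<or> degree (p k) < degree (p 0)"
    and "f meromorphic_on UNIV"
    and "\<not> (\<forall>\<^sub>\<approx>x\<in>UNIV. f x = 0)"
    and "\<forall>\<^sub>\<approx>x\<in>UNIV. (\<Sum>k\<le>n. poly (p k) x * (wilson ^^ k) f x) = 0"
  shows "growth_order f \<ge> 1 / 2"
proof (rule ccontr)
  assume "\<not> growth_order f \<ge> 1 / 2"
  then obtain \<rho> where \<rho>: "0 < \<rho>" "\<rho> < 1 / 2" "\<forall>\<^sub>F r in at_top. nevanlinna_T f r \<le> r powr \<rho>"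
    using growth_order_less_halfE[of f] by (auto simp: not_le)
  \<comment> \<open>A meromorphic function on the plane that is not identically 0 vanishes only on a
    sparse set.\<close>
  have nz: "\<forall>\<^sub>\<approx>x\<in>UNIV. f x \<noteq> 0"
    using meromorphic_imp_constant_or_avoid[OF assms(4), of 0] assms(5) by auto
  define C where "C = (2 * exp 8 :: real)"
  have "((\<lambda>x. poly (p k) x / poly (p 0) x) \<longlongrightarrow> 0) at_infinity" if "k \<in> {1..n}" for k
    using assms(3)[OF that] poly_divide_tendsto_0_at_infinity by auto
  hence "((\<lambda>x. \<Sum>k=1..n. C * norm (poly (p k) x / poly (p 0) x)) \<longlongrightarrow> (\<Sum>k=1..n. C * norm (0::complex))) at_infinity"
    by (intro tendsto_sum tendsto_mult_left tendsto_norm)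
  hence "\<forall>\<^sub>F x in at_infinity. (\<Sum>k=1..n. C * norm (poly (p k) x / poly (p 0) x)) < 1"
    by (rule order_tendstoD(2)) simp
  moreover have "\<forall>\<^sub>F x in at_infinity. poly (p 0) x \<noteq> 0"
  proof -
    have "finite {x. poly (p 0) x = 0}"
      using assms(2) by (rule poly_roots_finite)
    hence "bounded {x. poly (p 0) x = 0}"
      by (rule finite_imp_bounded)
    then obtain b where "\<And>x. poly (p 0) x = 0 \<Longrightarrow> norm x \<le> b"
      by (auto simp: bounded_iff)
    thus ?thesis
      by (intro eventually_at_infinityI[of "b + 1"]) force
  qed
  ultimately have "\<forall>\<^sub>F x in at_infinity. poly (p 0) x \<noteq> 0 \<and> (\<Sum>k=1..n. C * norm (poly (p k) x / poly (p 0) x)) < 1"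
    by eventually_elim auto
  then obtain b where b: "\<And>x. norm x \<ge> b \<Longrightarrow> poly (p 0) x \<noteq> 0 \<and> (\<Sum>k=1..n. C * norm (poly (p k) x / poly (p 0) x)) < 1"
    by (auto simp: eventually_at_infinity)
  \<comment> \<open>These are the shifts entering the first \<open>n\<close> iterates.
    \<open>R\<close> serves both the bound on the iterates and the dominance of
    \<open>p 0\<close>.\<close>
  define J where "J = (\<lambda>j. \<i> * of_int j / 2 :: complex) ` {- int n..int n}"
  define R where "R = max (real n / 2 + 1) b"
  have J_norm: "norm a \<le> (real n / 2 + 1) - 1" if "a \<in> J" for a
    using that by (auto simp: J_def norm_mult norm_divide)
  \<comment> \<open>Applied with \<open>A = n / 2 + 1\<close> and with the difference equation as
    \<open>E\<close>.\<close>
  obtain z where z: "norm z \<ge> R" "(\<Sum>k\<le>n. poly (p k) (z\<^sup>2) * (wilson ^^ k) f (z\<^sup>2)) = 0" "f (z\<^sup>2) \<noteq> 0"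
    "\<And>a. a \<in> J \<Longrightarrow> norm (f ((z + a)\<^sup>2)) \<le> C * norm (f (z\<^sup>2))"
    unfolding C_def
    by (rule slow_growth_comparable_shifts[OF assms(4) nz \<rho> _ J_norm _ assms(6), where R = R]) (auto simp: J_def)
  define x where "x = z\<^sup>2"
  have z1: "norm z \<ge> 1"
    using z(1) by (auto simp: R_def)
  have "norm z * 1 \<le> norm z * norm z"
    using z1 by (intro mult_left_mono) auto
  hence "norm x \<ge> b"
    using z(1) by (simp add: x_def R_def norm_mult power2_eq_square)
  note bx = b[OF this]
  have wil: "norm ((wilson ^^ k) f x) \<le> C * norm (f x)" if "k \<le> n" for k
    unfolding x_def
  proof (rule norm_wilson_iterate_le)
    show "norm (f ((z + \<i> * of_int j / 2)\<^sup>2)) \<le> C * norm (f (z\<^sup>2))" if "\<bar>j\<bar> \<le> int k" for j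
      using that \<open>k \<le> n\<close> by (intro z(4)) (auto simp: J_def abs_le_iff)
    show "real k / 2 + 1 \<le> norm z"
      using z(1) that by (simp add: R_def)
  qed
  have "{..n} = insert 0 {1..n}"
    by auto
  \<comment> \<open>Isolating the term of index 0, which is nonzero at \<open>x\<close>, makes it
    strictly smaller than itself in modulus.\<close>
  hence "poly (p 0) x * f x = - (\<Sum>k=1..n. poly (p k) x * (wilson ^^ k) f x)"
    using z(2) by (simp add: x_def[symmetric] add_eq_0_iff2)
  hence "norm (poly (p 0) x) * norm (f x) = norm (\<Sum>k=1..n. poly (p k) x * (wilson ^^ k) f x)"
    by (metis norm_minus_cancel norm_mult)
  also have "\<dots> \<le> (\<Sum>k=1..n. norm (poly (p k) x) * (C * norm (f x)))"
    using wil by (intro sum_norm_le) (auto simp: norm_mult intro!: mult_left_mono)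
  also have "\<dots> = (norm (poly (p 0) x) * norm (f x)) * (\<Sum>k=1..n. C * norm (poly (p k) x / poly (p 0) x))"
    using bx by (simp add: sum_distrib_left norm_divide mult_ac)
  also have "\<dots> < (norm (poly (p 0) x) * norm (f x)) * 1"
    using bx z(3) by (intro mult_strict_left_mono) (auto simp: x_def)
  finally show False
    by simp
qed

end
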